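(* Let $h : S_1 \to S_1$ be an orientation preserving homeomorphism for which $h(\mathbf{Z}[\frac{1}{2}]) = \mathbf{Z}[\frac{1}{2}]$, and assume that $h\nu_2 h^{-1}$ and $h^{-1}\nu_2 h$ are both in $\overline{T}_{2,1}$. Then $h \in T_{2,1}$.
   Context: $S_1=\mathbf{R}/\mathbf{Z}$; linearity, slope, etc. of functions on $S_1$ are understood exactly as on $\mathbf{R}$. $\mathbf{Z}[\frac12]$ denotes the set of points of $S_1$ represented by numbers $a2^b$, $a,b\in\mathbf{Z}$. The map $\nu_2:S_1\to S_1$ is $\nu_2(x)=2x$. A break of $f$ is a point of discontinuity of $f'$. A continuous function is piecewise linear (PL) if each point of its domain has an open neighborhood on which it is at most the only break. $T_{2,1}$ is the group of homeomorphisms $f:S_1\to S_1$ such that: (1) $f$ is PL; (2) $f$ is orientation preserving; (3) all slopes of $f$ are integral powers of $2$; (4) the breaks of $f$ lie in a discrete subset of $\mathbf{Z}[\frac12]$; (5) $f(\mathbf{Z}[\frac12])\subseteq\mathbf{Z}[\frac12]$. $\overline T_{2,1}$ is the monoid of functions $f$ whose domain and range are open subsets of $S_1$ and which satisfy (1)–(5), where (2) is interpreted locally (so $f$ is a local homeomorphism, not necessarily injective), (4) requires the breaks to lie in $\mathbf{Z}[\frac12]$ and be discrete in the domain of $f$, and (5) applies to points of $\mathbf{Z}[\frac12]$ in the domain; for instance $\nu_2\in\overline T_{2,1}$. *)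

theory Defs
  imports "HOL-Analysis.Analysis"
begin

section \<open>The circle \<open>\<real>/\<int>\<close>\<close>

quotient_type circle = real / "\<lambda>x y::real. x - y \<in> \<int>"
  morphisms rep_circle to_circle
proof (rule equivpI)
  show "reflp (\<lambda>x y::real. x - y \<in> \<int>)"
    by (simp add: reflp_def)
  show "symp (\<lambda>x y::real. x - y \<in> \<int>)"
    by (metis (no_types, lifting) Ints_minus minus_diff_eq sympI)
  show "transp (\<lambda>x y::real. x - y \<in> \<int>)"
  proof (rule transpI)
    fix x y z :: real
    assume "x - y \<in> \<int>" "y - z \<in> \<int>"
    then have "(x - y) + (y - z) \<in> \<int>" by (rule Ints_add)
    then show "x - z \<in> \<int>" by simp
  qed
qed

instantiation circle :: topological_space
begin

definition open_circle :: "circle set \<Rightarrow> bool"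
  where "open_circle U \<longleftrightarrow> open (to_circle -` U)"

instance
proof
  show "open (UNIV :: circle set)"
    by (simp add: open_circle_def)
next
  fix S T :: "circle set"
  assume "open S" "open T"
  then show "open (S \<inter> T)"
    by (auto simp: open_circle_def intro: open_Int)
next
  fix K :: "circle set set"
  assume "\<forall>S\<in>K. open S"
  then show "open (\<Union>K)"
    by (auto simp: open_circle_def vimage_Union)
qed

end

lift_definition nu2 :: "circle \<Rightarrow> circle" is "\<lambda>x. 2 * x"
proof -
  fix x y :: real
  assume "x - y \<in> \<int>"
  then have "2 * (x - y) \<in> \<int>" by (intro Ints_mult) auto
  then show "2 * x - 2 * y \<in> \<int>" by (simp add: right_diff_distrib)
qed

definition dyadic :: "circle set"
  where "dyadic = {to_circle (of_int a * 2 powi b) | a b :: int. True}"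


section \<open>Linearity, slopes and breaks\<close>

text \<open>
  In this section a partial function on the circle is a total function \<open>f\<close> together with
  an open domain \<open>U\<close>.  All notions at a point are local, so the values of \<open>f\<close> outside \<open>U\<close>
  are irrelevant at the points of \<open>U\<close>.  Notions from the real line are transported through
  lifts to \<open>\<real>\<close>, in the source and in the target.
\<close>

definition linear_near :: "(circle \<Rightarrow> circle) \<Rightarrow> circle \<Rightarrow> bool"
  where "linear_near f x \<longleftrightarrow>
    (\<exists>t a b. to_circle t = x \<and>
      (\<forall>\<^sub>F s in nhds t. f (to_circle s) = to_circle (a * s + b)))"

text \<open>A lift is unique near \<open>t\<close> up to an integer constant once it is continuous at \<open>t\<close>,
  so the derivative below does not depend on the choice of \<open>t\<close> and \<open>F\<close>.\<close>

definition has_slope :: "(circle \<Rightarrow> circle) \<Rightarrow> circle \<Rightarrow> real \<Rightarrow> bool"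
  where "has_slope f x m \<longleftrightarrow>
    (\<exists>t F. to_circle t = x \<and>
      (\<forall>\<^sub>F s in nhds t. f (to_circle s) = to_circle (F s)) \<and>
      (F has_real_derivative m) (at t))"

definition slope :: "(circle \<Rightarrow> circle) \<Rightarrow> circle \<Rightarrow> real"
  where "slope f x = (THE m. has_slope f x m)"

definition slope_dom :: "circle set \<Rightarrow> (circle \<Rightarrow> circle) \<Rightarrow> circle set"
  where "slope_dom U f = {x \<in> U. \<exists>m. has_slope f x m}"

text \<open>Points where the derivative does not exist count as discontinuities of the derivative.\<close>

definition breaks :: "circle set \<Rightarrow> (circle \<Rightarrow> circle) \<Rightarrow> circle set"
  where "breaks U f = {x \<in> U. x \<notin> slope_dom U f \<or>
    \<not> (slope f \<longlongrightarrow> slope f x) (at x within slope_dom U f)}"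

text \<open>The condition on breaks alone would admit every continuously differentiable function,
  so the linearity of the pieces is required explicitly.\<close>

definition PL_on :: "circle set \<Rightarrow> (circle \<Rightarrow> circle) \<Rightarrow> bool"
  where "PL_on U f \<longleftrightarrow> continuous_on U f \<and>
    (\<forall>x\<in>U. \<exists>V. open V \<and> x \<in> V \<and> V \<subseteq> U \<and>
      (\<forall>y\<in>V - {x}. y \<notin> breaks U f \<and> linear_near f y))"

definition slopes_powers_of_2 :: "circle set \<Rightarrow> (circle \<Rightarrow> circle) \<Rightarrow> bool"
  where "slopes_powers_of_2 U f \<longleftrightarrow>
    (\<forall>x\<in>U. \<forall>m. has_slope f x m \<longrightarrow> (\<exists>k::int. m = 2 powi k))"


section \<open>Orientation\<close>

definition orientation_preserving_homeo :: "(circle \<Rightarrow> circle) \<Rightarrow> bool"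
  where "orientation_preserving_homeo h \<longleftrightarrow>
    (\<exists>g. homeomorphism UNIV UNIV h g) \<and>
    (\<exists>F::real \<Rightarrow> real. continuous_on UNIV F \<and> strict_mono F \<and>
      (\<forall>t. h (to_circle t) = to_circle (F t)))"

definition locally_orientation_preserving_on :: "circle set \<Rightarrow> (circle \<Rightarrow> circle) \<Rightarrow> bool"
  where "locally_orientation_preserving_on U f \<longleftrightarrow>
    (\<forall>t. to_circle t \<in> U \<longrightarrow>
      (\<exists>e>0. \<exists>F::real \<Rightarrow> real. continuous_on (ball t e) F \<and> strict_mono_on (ball t e) F \<and>
        (\<forall>s\<in>ball t e. to_circle s \<in> U \<and> f (to_circle s) = to_circle (F s))))"


section \<open>The group \<open>T\<^bsub>2,1\<^esub>\<close> and its local version\<close>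

definition T21 :: "(circle \<Rightarrow> circle) set"
  where "T21 = {f. orientation_preserving_homeo f \<and>
    PL_on UNIV f \<and>
    slopes_powers_of_2 UNIV f \<and>
    (\<exists>B. B \<subseteq> dyadic \<and> discrete B \<and> breaks UNIV f \<subseteq> B) \<and>
    f ` dyadic \<subseteq> dyadic}"

text \<open>The elements of the monoid that have domain \<open>U\<close>.\<close>

definition T21_local :: "circle set \<Rightarrow> (circle \<Rightarrow> circle) set"
  where "T21_local U = {f. open U \<and> open (f ` U) \<and>
    PL_on U f \<and>
    locally_orientation_preserving_on U f \<and>
    slopes_powers_of_2 U f \<and>
    breaks U f \<subseteq> dyadic \<and> breaks U f sparse_in U \<and>
    f ` (dyadic \<inter> U) \<subseteq> dyadic}"

end

theory Submission
  imports Defs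
begin

text \<open>
  Lift \<open>h\<close> to \<open>H\<close> on the real line and let \<open>G\<close> be the inverse of \<open>H\<close>. The hypotheses say that
  \<open>F y = H (2 * G y)\<close> and \<open>E x = G (2 * H x)\<close> are affine, with slopes powers of 2, on all dyadic
  cells \<open>[p / 2 ^ M, (p + 1) / 2 ^ M]\<close> of some level \<open>M\<close>. Since \<open>H (2 * x) = F (H x)\<close>, the shapes of
  the graph of \<open>H\<close> over a small cell \<open>(n + 1, p)\<close> and over \<open>(n, p)\<close> are similar, so the shape depends
  only on finitely many last binary digits of \<open>p\<close>. In fact it does not depend on \<open>p\<close> at all, which
  forces \<open>H\<close> to be affine on small cells because both halves of a cell are similar to the cell.

  If the shape did depend on the digits, it would determine the last one. Consider the conjugates
  \<open>x \<mapsto> G (H x + 2 ^ - r)\<close> of dyadic translations. They are obtained from \<open>x \<mapsto> x + 1\<close> by repeated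
  conjugation with \<open>E\<close>, so they map small cells affinely onto cells, and they preserve shapes. As the
  parity of the index is preserved, two halves of a cell are mapped to two halves of a cell, and so
  cells of a fixed size are mapped onto cells for every \<open>r\<close>. This is absurd for large \<open>r\<close>.
\<close>

section \<open>Dyadic cells\<close>

definition dyadic_reals :: "real set"
  where "dyadic_reals = {of_int a / 2 ^ n | (a::int) (n::nat). True}"

text \<open>Cells are closed so that neighbours share an endpoint; an affine formula on a cell then
  covers the values at both grid points.\<close>

definition cell :: "nat \<Rightarrow> int \<Rightarrow> real set"
  where "cell n p = {of_int p / 2 ^ n .. (of_int p + 1) / 2 ^ n}"

text \<open>One level \<open>M\<close> serves the whole line, so all breaks lie on one grid.
  Continuity is implied, since the cells are closed.\<close>

definition dyadic_PL :: "(real \<Rightarrow> real) \<Rightarrow> bool"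
  where "dyadic_PL f \<longleftrightarrow>
    (\<exists>M. \<forall>p. \<exists>j::int. \<exists>b. \<forall>x\<in>cell M p. f x = 2 powi j * x + b)"

text \<open>The free bound \<open>L\<close> on the image level is what makes the property stable
  under composition.\<close>

definition preserves_small_cells :: "(real \<Rightarrow> real) \<Rightarrow> bool"
  where "preserves_small_cells f \<longleftrightarrow>
    (\<forall>L. \<exists>m. \<forall>n\<ge>m. \<forall>p::int. \<exists>n'\<ge>L. \<exists>p'::int. \<forall>t\<in>{0..1}.
      f ((of_int p + t) / 2 ^ n) = (of_int p' + t) / 2 ^ n')"

lemma cell_param: "x \<in> cell n p \<longleftrightarrow> (\<exists>t\<in>{0..1}. x = (of_int p + t) / 2 ^ n)"
  (is "?A \<longleftrightarrow> ?B")
proof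
  show ?B if ?A
  proof -
    have "of_int p \<le> x * 2 ^ n" "x * 2 ^ n \<le> of_int p + 1"
      using that by (simp_all add: cell_def divide_le_eq le_divide_eq)
    then have "x * 2 ^ n - of_int p \<in> {0..1}"
      by simp
    moreover have "x = (of_int p + (x * 2 ^ n - of_int p)) / 2 ^ n"
      by simp
    ultimately show ?B
      by blast
  qed
  show ?A if ?B
    using that by (auto simp: cell_def divide_right_mono)
qed

lemma half_cell_subset:
  assumes "q = 2 * p \<or> q = 2 * p + 1"
  shows "cell (Suc n) q \<subseteq> cell n p"
proof -
  have "of_int p / 2 ^ n = (of_int (2 * p) :: real) / 2 ^ Suc n"
    "(of_int p + 1) / 2 ^ n = (of_int (2 * p + 1) + 1 :: real) / 2 ^ Suc n"
    by (simp_all add: add_divide_distrib)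
  moreover have "(of_int (2 * p) :: real) / 2 ^ Suc n \<le> of_int q / 2 ^ Suc n"
    "(of_int q + 1 :: real) / 2 ^ Suc n \<le> (of_int (2 * p + 1) + 1) / 2 ^ Suc n"
    using assms by (intro divide_right_mono; auto)+
  ultimately show ?thesis
    by (auto simp: cell_def)
qed

lemma preserves_small_cells_comp:
  assumes "preserves_small_cells f" "preserves_small_cells g"
  shows "preserves_small_cells (\<lambda>x. g (f x))"
  unfolding preserves_small_cells_def
proof
  fix L
  obtain m where m: "\<forall>n\<ge>m. \<forall>p::int. \<exists>n'\<ge>L. \<exists>p'::int. \<forall>t\<in>{0..1}.
      g ((of_int p + t) / 2 ^ n) = (of_int p' + t) / 2 ^ n'"
    using assms(2) unfolding preserves_small_cells_def by blast
  obtain m' where m': "\<forall>n\<ge>m'. \<forall>p::int. \<exists>n'\<ge>m. \<exists>p'::int. \<forall>t\<in>{0..1}.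
      f ((of_int p + t) / 2 ^ n) = (of_int p' + t) / 2 ^ n'"
    using assms(1) unfolding preserves_small_cells_def by blast
  show "\<exists>m. \<forall>n\<ge>m. \<forall>p::int. \<exists>n'\<ge>L. \<exists>p'::int. \<forall>t\<in>{0..1}.
      g (f ((of_int p + t) / 2 ^ n)) = (of_int p' + t) / 2 ^ n'"
  proof (rule exI[of _ m'], intro allI impI)
    fix n and p :: int assume "m' \<le> n"
    then obtain n1 and p1 :: int where 1: "n1 \<ge> m" "\<forall>t\<in>{0..1}. f ((of_int p + t) / 2 ^ n) = (of_int p1 + t) / 2 ^ n1"
      using m' by metis
    then obtain n2 and p2 :: int where 2: "n2 \<ge> L" "\<forall>t\<in>{0..1}. g ((of_int p1 + t) / 2 ^ n1) = (of_int p2 + t) / 2 ^ n2"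
      using m by metis
    show "\<exists>n'\<ge>L. \<exists>p'::int. \<forall>t\<in>{0..1}. g (f ((of_int p + t) / 2 ^ n)) = (of_int p' + t) / 2 ^ n'"
      using 1 2 by auto
  qed
qed

section \<open>Arithmetic in the ring Z[1/2]\<close>

lemma dyadic_realsE:
  assumes "x \<in> dyadic_reals"
  obtains a :: int and n where "x = of_int a / 2 ^ n"
  using assms by (auto simp: dyadic_reals_def)

lemma dyadic_realsI: "of_int a / 2 ^ n \<in> dyadic_reals"
  by (auto simp: dyadic_reals_def)

lemma dyadic_reals_iff_Ints: "x \<in> dyadic_reals \<longleftrightarrow> (\<exists>n. x * 2 ^ n \<in> \<int>)"
proof
  assume "x \<in> dyadic_reals"
  then obtain a :: int and n where "x = of_int a / 2 ^ n"
    by (elim dyadic_realsE)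
  then show "\<exists>n. x * 2 ^ n \<in> \<int>"
    by (intro exI[of _ n]) simp
next
  assume "\<exists>n. x * 2 ^ n \<in> \<int>"
  then obtain n a where "x * 2 ^ n = of_int a"
    by (auto elim: Ints_cases)
  then have "x = of_int a / 2 ^ n"
    by (simp add: field_simps)
  then show "x \<in> dyadic_reals"
    by (simp add: dyadic_realsI)
qed

lemma Ints_mult_pow2_mono:
  fixes x :: real
  assumes "x * 2 ^ m \<in> \<int>" "m \<le> n"
  shows "x * 2 ^ n \<in> \<int>"
proof -
  have "(2::real) ^ n = 2 ^ m * 2 ^ (n - m)"
    using assms(2) by (simp flip: power_add)
  then have "x * 2 ^ n = x * 2 ^ m * 2 ^ (n - m)"
    by (simp only: mult.assoc)
  moreover have "x * 2 ^ m * 2 ^ (n - m) \<in> \<int>"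
    using assms(1) by (rule Ints_mult) simp
  ultimately show ?thesis
    by (simp only:)
qed

lemma powi_two_inject: "(2::real) powi i = 2 powi j \<longleftrightarrow> i = j"
  using power_int_strict_increasing[of i j "2::real"] power_int_strict_increasing[of j i "2::real"]
  by (cases i j rule: linorder_cases) auto

lemma dyadic_reals_add:
  assumes "x \<in> dyadic_reals" "y \<in> dyadic_reals"
  shows "x + y \<in> dyadic_reals"
proof -
  obtain m n where "x * 2 ^ m \<in> \<int>" "y * 2 ^ n \<in> \<int>"
    using assms dyadic_reals_iff_Ints by metis
  then have "x * 2 ^ max m n \<in> \<int>" "y * 2 ^ max m n \<in> \<int>"
    by (auto intro: Ints_mult_pow2_mono)
  then have "(x + y) * 2 ^ max m n \<in> \<int>"
    by (simp add: distrib_right)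
  then show ?thesis
    by (auto simp: dyadic_reals_iff_Ints)
qed

lemma dyadic_reals_mult:
  assumes "x \<in> dyadic_reals" "y \<in> dyadic_reals"
  shows "x * y \<in> dyadic_reals"
proof -
  obtain m n where "x * 2 ^ m \<in> \<int>" "y * 2 ^ n \<in> \<int>"
    using assms dyadic_reals_iff_Ints by metis
  then have "(x * 2 ^ m) * (y * 2 ^ n) \<in> \<int>"
    by (rule Ints_mult)
  then have "(x * y) * 2 ^ (m + n) \<in> \<int>"
    by (simp add: power_add mult_ac)
  then show ?thesis
    by (auto simp: dyadic_reals_iff_Ints)
qed

lemma of_int_dyadic_reals: "of_int a \<in> dyadic_reals"
  using dyadic_realsI[of a 0] by simp

lemma Ints_dyadic_reals: "x \<in> \<int> \<Longrightarrow> x \<in> dyadic_reals"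
  by (auto elim!: Ints_cases simp: of_int_dyadic_reals)

lemma dyadic_reals_minus: "x \<in> dyadic_reals \<Longrightarrow> - x \<in> dyadic_reals"
  by (auto simp: dyadic_reals_iff_Ints)

lemma dyadic_reals_diff: "x \<in> dyadic_reals \<Longrightarrow> y \<in> dyadic_reals \<Longrightarrow> x - y \<in> dyadic_reals"
  unfolding diff_conv_add_uminus by (intro dyadic_reals_add dyadic_reals_minus)

lemma powi_two_dyadic_reals: "2 powi k \<in> dyadic_reals"
proof (cases "k \<ge> 0")
  case True
  then have "(2::real) powi k = of_int (2 ^ nat k)"
    by (simp add: power_int_def)
  then show ?thesis
    by (simp only: of_int_dyadic_reals)
next
  case False
  then have "(2::real) powi k = 2 powi (- int (nat (- k)))"
    by simp
  also have "\<dots> = of_int 1 / 2 ^ nat (- k)"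
    by (simp only: power_int_minus power_int_of_nat of_int_1 inverse_eq_divide)
  finally have "(2::real) powi k = of_int 1 / 2 ^ nat (- k)" .
  then show ?thesis
    by (simp only: dyadic_realsI)
qed

text \<open>These are the positive units of Z[1/2]: the numerators of \<open>x\<close> and
  \<open>1 / x\<close> multiply to a power of 2, so each of them is a power of 2.\<close>

lemma dyadic_unit_powi:
  fixes x :: real
  assumes "x \<in> dyadic_reals" "1 / x \<in> dyadic_reals" "x > 0"
  shows "\<exists>k::int. x = 2 powi k"
proof -
  obtain a :: int and m where a: "x = of_int a / 2 ^ m"
    using assms(1) by (elim dyadic_realsE)
  obtain c :: int and n where c: "1 / x = of_int c / 2 ^ n"
    using assms(2) by (elim dyadic_realsE)
  have pos: "a > 0" "c > 0"
  proof -
    show "a > 0"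
      using assms(3) a by (auto simp: zero_less_divide_iff)
    have "1 / x > 0"
      using assms(3) by simp
    then show "c > 0"
      unfolding c by (auto simp: zero_less_divide_iff)
  qed
  have "(of_int (a * c) :: real) = (x * 2 ^ m) * (1 / x * 2 ^ n)"
    unfolding c by (simp add: a)
  also have "\<dots> = of_int (2 ^ (m + n))"
    using assms(3) by (simp add: power_add)
  finally have "a * c = 2 ^ (m + n)"
    by (simp only: of_int_eq_iff)
  then have "a dvd 2 ^ (m + n)"
    by (metis dvd_triv_left)
  then have "nat a dvd 2 ^ (m + n)"
    using pos(1) by (simp add: nat_dvd_iff)
  then obtain i where "nat a = 2 ^ i"
    using divides_primepow_nat[of 2 "nat a" "m + n"] by auto
  then have "int (nat a) = 2 ^ i"
    by simp
  then have "a = 2 ^ i"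
    using pos(1) by simp
  then have "x = 2 powi (int i - int m)"
    using a by (simp add: power_int_diff)
  then show ?thesis by blast
qed

section \<open>Quasi-periodic functions and bounds on denominators\<close>

lemma periodic_shift:
  fixes e :: "int \<Rightarrow> real"
  assumes "\<And>q. e (q + K) = e q + Q"
  shows "e (q + K * i) = e q + of_int i * Q"
proof (induction i rule: int_induct[of _ 0])
  case (step1 i)
  then show ?case
    using assms[of "q + K * i"] by (simp add: algebra_simps)
next
  case (step2 i)
  then show ?case
    using assms[of "q + K * (i - 1)"] by (simp add: algebra_simps)
qed simp

lemma shift_of_int:
  fixes F :: "real \<Rightarrow> real"
  assumes "\<And>t. F (t + 1) = F t + 1"
  shows "F (t + of_int i) = F t + of_int i"
  using periodic_shift[of "\<lambda>q. F (t + of_int q)" 1 1 0 i] assms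
  by (simp add: add.assoc[symmetric])

text \<open>Reduction modulo \<open>K\<close> leaves finitely many denominators to bound and changes
  the values only by multiples of the integer \<open>Q\<close>.\<close>

lemma uniform_denominator:
  fixes e :: "int \<Rightarrow> real"
  assumes per: "\<And>q. e (q + K) = e q + of_int Q" and K: "K > 0"
    and dy: "\<And>q. e q \<in> dyadic_reals"
  shows "\<exists>B. \<forall>q. e q * 2 ^ B \<in> \<int>"
proof -
  have "\<forall>q. \<exists>n. e q * 2 ^ n \<in> \<int>"
    using dy by (auto simp: dyadic_reals_iff_Ints)
  then obtain N where N: "\<And>q. e q * 2 ^ N q \<in> \<int>"
    by metis
  define B where "B = Max (N ` {0..<K})"
  have B: "e q * 2 ^ B \<in> \<int>" if "q \<in> {0..<K}" for q
  proof (rule Ints_mult_pow2_mono[OF N])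
    show "N q \<le> B"
      unfolding B_def using that by (intro Max_ge) auto
  qed
  show ?thesis
  proof (intro exI[of _ B] allI)
    fix q
    have "e q = e (q mod K + K * (q div K))"
      by (simp add: mod_mult_div_eq)
    also have "\<dots> = e (q mod K) + of_int (q div K) * of_int Q"
      by (rule periodic_shift) (rule per)
    finally have "e q * 2 ^ B = e (q mod K) * 2 ^ B + of_int (q div K) * of_int Q * 2 ^ B"
      by (simp add: algebra_simps)
    then show "e q * 2 ^ B \<in> \<int>"
      using B[of "q mod K"] K by simp
  qed
qed

text \<open>The preimages under \<open>\<phi>\<close> of the grid points of level \<open>M\<close>
  are grid points of level \<open>B\<close>. A cell of level \<open>n \<ge> B\<close> has none of
  them in its interior, so its image cannot straddle two cells.\<close>

lemma fine_cells:
  fixes \<phi> \<psi> :: "real \<Rightarrow> real"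
  assumes mono: "strict_mono \<phi>" and inv: "\<And>y. \<phi> (\<psi> y) = y"
    and B: "\<And>q::int. \<psi> (of_int q / 2 ^ M) * 2 ^ B \<in> \<int>" and n: "n \<ge> B"
  shows "\<exists>q. \<phi> ` cell n p \<subseteq> cell M q"
proof -
  \<comment> \<open>The cell containing the image of the left endpoint. The preimage of its right
    end is a grid point strictly to the right of \<open>p / 2 ^ n\<close>, hence at or beyond
    \<open>(p + 1) / 2 ^ n\<close>.\<close>
  define q where "q = \<lfloor>\<phi> (of_int p / 2 ^ n) * 2 ^ M\<rfloor>"
  have lo: "of_int q / 2 ^ M \<le> \<phi> (of_int p / 2 ^ n)"
    unfolding q_def by (simp add: divide_le_eq)
  have "\<phi> (of_int p / 2 ^ n) < of_int (q + 1) / 2 ^ M"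
    unfolding q_def by (simp add: less_divide_eq)
  then have "of_int p / 2 ^ n < \<psi> (of_int (q + 1) / 2 ^ M)"
    by (metis inv mono strict_mono_less)
  moreover obtain c where c: "\<psi> (of_int (q + 1) / 2 ^ M) * 2 ^ n = of_int c"
    using Ints_mult_pow2_mono[OF B n] by (metis Ints_cases)
  ultimately have "of_int p < (of_int c :: real)"
    by (simp add: divide_less_eq)
  then have "p + 1 \<le> c"
    by simp
  then have "of_int (p + 1) \<le> (of_int c :: real)"
    by (simp only: of_int_le_iff)
  then have "of_int p + 1 \<le> (of_int c :: real)"
    by simp
  then have "(of_int p + 1) / 2 ^ n \<le> \<psi> (of_int (q + 1) / 2 ^ M)"
    using c by (simp add: divide_le_eq)
  then have hi: "\<phi> ((of_int p + 1) / 2 ^ n) \<le> (of_int q + 1) / 2 ^ M"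
    using inv mono by (metis of_int_add of_int_1 strict_mono_less_eq)
  have "\<phi> x \<in> cell M q" if "x \<in> cell n p" for x
  proof -
    have "\<phi> (of_int p / 2 ^ n) \<le> \<phi> x" "\<phi> x \<le> \<phi> ((of_int p + 1) / 2 ^ n)"
      using that mono by (auto simp: cell_def strict_mono_less_eq)
    then show ?thesis
      using lo hi by (auto simp: cell_def)
  qed
  then show ?thesis by blast
qed

text \<open>The breaks of \<open>g\<close> are among the values of \<open>f\<close> at grid points.
  By periodicity these have a common denominator \<open>2 ^ B\<close>, so \<open>g\<close> maps each
  cell of level \<open>B\<close> into one cell on which the affine formula for \<open>f\<close> can
  be inverted.\<close>

lemma dyadic_PL_inverse:
  assumes mono: "strict_mono f" and inv: "\<And>y. f (g y) = y" "\<And>x. g (f x) = x"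
    and per: "\<And>x. f (x + of_int P) = f x + of_int Q" and P: "P > 0"
    and dy: "\<And>x. x \<in> dyadic_reals \<Longrightarrow> f x \<in> dyadic_reals"
    and PL: "dyadic_PL f"
  shows "dyadic_PL g"
proof -
  obtain M where M: "\<And>p. \<exists>j::int. \<exists>b. \<forall>x\<in>cell M p. f x = 2 powi j * x + b"
    using PL unfolding dyadic_PL_def by blast
  have "\<exists>B. \<forall>q::int. f (of_int q / 2 ^ M) * 2 ^ B \<in> \<int>"
  proof (rule uniform_denominator)
    fix q :: int
    have "(of_int (q + P * 2 ^ M) :: real) / 2 ^ M = of_int q / 2 ^ M + of_int P"
      by (simp add: field_simps)
    then show "f (of_int (q + P * 2 ^ M) / 2 ^ M) = f (of_int q / 2 ^ M) + of_int Q"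
      using per by simp
  qed (use P dy dyadic_realsI in auto)
  then obtain B where B: "\<And>q::int. f (of_int q / 2 ^ M) * 2 ^ B \<in> \<int>"
    by blast
  have "strict_mono g"
    using mono inv by (metis strict_mono_def linorder_neqE order_less_asym)
  have "\<exists>j::int. \<exists>b. \<forall>y\<in>cell B p. g y = 2 powi j * y + b" for p
  proof -
    obtain q where q: "g ` cell B p \<subseteq> cell M q"
      using fine_cells[of g f M B B p] \<open>strict_mono g\<close> inv B by auto
    obtain j :: int and b where jb: "\<And>x. x \<in> cell M q \<Longrightarrow> f x = 2 powi j * x + b"
      using M by blast
    have "g y = 2 powi (-j) * y + (- b * 2 powi (-j))" if "y \<in> cell B p" for y
    proof -
      have "y = 2 powi j * g y + b"
        using jb[of "g y"] q that inv by auto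
      then have "g y = (y - b) / 2 powi j"
        by (simp add: field_simps)
      then show ?thesis
        by (simp add: power_int_minus field_simps)
    qed
    then show ?thesis by blast
  qed
  then show ?thesis
    unfolding dyadic_PL_def by blast
qed

text \<open>Inside a cell of level \<open>M\<close> the map scales small cells by
  \<open>2 powi j\<close>. The image is again a dyadic cell once its level is at least
  \<open>B\<close>, a common denominator exponent of the values at grid points. Periodicity bounds
  both the denominators and the exponents \<open>j\<close>.\<close>

lemma dyadic_PL_preserves_small_cells:
  assumes PL: "dyadic_PL f"
    and per: "\<And>x. f (x + of_int P) = f x + of_int Q" and P: "P > 0"
    and dy: "\<And>x. x \<in> dyadic_reals \<Longrightarrow> f x \<in> dyadic_reals"
  shows "preserves_small_cells f"
proof -
  obtain M where M: "\<And>p. \<exists>j::int. \<exists>b. \<forall>x\<in>cell M p. f x = 2 powi j * x + b"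
    using PL unfolding dyadic_PL_def by blast
  then obtain j :: "int \<Rightarrow> int" and b where jb: "\<And>p x. x \<in> cell M p \<Longrightarrow> f x = 2 powi j p * x + b p"
    by metis
  define e where "e q = f (of_int q / 2 ^ M)" for q :: int
  have eper: "e (q + P * 2 ^ M) = e q + of_int Q" for q
  proof -
    have "(of_int (q + P * 2 ^ M) :: real) / 2 ^ M = of_int q / 2 ^ M + of_int P"
      by (simp add: field_simps)
    then show ?thesis
      using per by (simp add: e_def)
  qed
  have ediff: "e (q + 1) - e q = 2 powi j q / 2 ^ M" for q
  proof -
    have "e q = 2 powi j q * (of_int q / 2 ^ M) + b q"
      unfolding e_def by (rule jb) (simp add: cell_def divide_right_mono)
    moreover have "e (q + 1) = 2 powi j q * (of_int (q + 1) / 2 ^ M) + b q"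
      unfolding e_def by (rule jb) (simp add: cell_def divide_right_mono)
    ultimately show ?thesis
      by (simp add: field_simps)
  qed
  have jper: "j (q + P * 2 ^ M) = j q" for q
  proof -
    have "e (q + P * 2 ^ M + 1) - e (q + P * 2 ^ M) = e (q + 1) - e q"
      using eper[of q] eper[of "q + 1"] by (simp add: add_ac)
    then have "(2::real) powi j (q + P * 2 ^ M) = 2 powi j q"
      by (simp add: ediff)
    then show ?thesis
      by (simp add: powi_two_inject)
  qed
  have K: "P * 2 ^ M > 0"
    using P by simp
  obtain B where B: "\<And>q. e q * 2 ^ B \<in> \<int>"
    using uniform_denominator[of e "P * 2 ^ M" Q] eper K dy dyadic_realsI by (auto simp: e_def)
  \<comment> \<open>An upper bound for all exponents; \<open>nat\<close> turns a negative maximum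
    into 0, which is still a bound.\<close>
  define C where "C = nat (Max (j ` {0..<P * 2 ^ M}))"
  have C: "j q \<le> int C" for q
  proof -
    have "real_of_int (j (q mod (P * 2 ^ M) + P * 2 ^ M * (q div (P * 2 ^ M)))) =
        real_of_int (j (q mod (P * 2 ^ M))) + of_int (q div (P * 2 ^ M)) * 0"
      by (rule periodic_shift) (simp add: jper)
    then have "j q = j (q mod (P * 2 ^ M))"
      by (simp add: mod_mult_div_eq)
    also have "j (q mod (P * 2 ^ M)) \<le> Max (j ` {0..<P * 2 ^ M})"
      using K by (intro Max_ge) auto
    finally show ?thesis
      by (simp add: C_def)
  qed
  show ?thesis
    unfolding preserves_small_cells_def
  proof (intro allI)
    fix L
    show "\<exists>m. \<forall>n\<ge>m. \<forall>p::int. \<exists>n'\<ge>L. \<exists>p'::int. \<forall>t\<in>{0..1}.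
      f ((of_int p + t) / 2 ^ n) = (of_int p' + t) / 2 ^ n'"
    \<comment> \<open>The cell fits into one of level \<open>M\<close>, and since
      \<open>j q \<le> C\<close> the image level \<open>n - j q\<close> is at least
      \<open>M + L + B\<close>.\<close>
    proof (rule exI[of _ "M + L + B + C"], intro allI impI)
      fix n and p :: int assume n: "M + L + B + C \<le> n"
      define q where "q = p div 2 ^ (n - M)"
      define r where "r = p mod 2 ^ (n - M)"
      have p: "p = q * 2 ^ (n - M) + r" and r: "0 \<le> r" "r < 2 ^ (n - M)"
        unfolding q_def r_def by (simp_all only: div_mult_mod_eq) simp_all
      have pow: "(2::real) ^ n = 2 ^ (n - M) * 2 ^ M"
        using n by (simp flip: power_add)
      define n' where "n' = nat (int n - j q)"
      have n': "int n' = int n - j q" "n' \<ge> L" "n' \<ge> B"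
        using C[of q] n by (auto simp: n'_def)
      have powj: "(2::real) powi j q = 2 ^ n / 2 ^ n'"
      proof -
        have "(2::real) powi j q = 2 powi (int n - int n')"
          using n' by simp
        then show ?thesis
          by (simp add: power_int_diff)
      qed
      obtain c where c: "e q * 2 ^ n' = of_int c"
        using Ints_mult_pow2_mono[OF B[of q] n'(3)] by (metis Ints_cases)
      have "f ((of_int p + t) / 2 ^ n) = (of_int (c + r) + t) / 2 ^ n'" if t: "t \<in> {0..1}" for t
      proof -
        \<comment> \<open>The parameter of the same point relative to the surrounding cell
          \<open>q\<close> of level \<open>M\<close>.\<close>
        define s where "s = (of_int r + t) / 2 ^ (n - M)"
        have s: "0 \<le> s" "s \<le> 1"
        proof -
          show "0 \<le> s"
            using r t by (simp add: s_def)
          have "of_int r + t \<le> of_int (r + 1)"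
            using t by simp
          also have "\<dots> \<le> (of_int (2 ^ (n - M)) :: real)"
            using r by (subst of_int_le_iff) simp
          finally show "s \<le> 1"
            by (simp add: s_def divide_le_eq)
        qed
        have x: "(of_int p + t) / 2 ^ n = (of_int q + s) / 2 ^ M"
          unfolding s_def pow p by (simp add: field_simps)
        have "f ((of_int q + s) / 2 ^ M) = 2 powi j q * ((of_int q + s) / 2 ^ M) + b q"
          by (rule jb) (use s in \<open>auto simp: cell_param\<close>)
        moreover have "e q = 2 powi j q * (of_int q / 2 ^ M) + b q"
          unfolding e_def by (rule jb) (simp add: cell_def divide_right_mono)
        ultimately have "f ((of_int p + t) / 2 ^ n) = e q + 2 powi j q * (s / 2 ^ M)"
          unfolding x by (simp add: distrib_left add_divide_distrib)
        also have "\<dots> = e q + (of_int r + t) / 2 ^ n'"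
          unfolding powj s_def pow by (simp add: field_simps)
        also have "\<dots> = (of_int (c + r) + t) / 2 ^ n'"
          using c by (simp add: field_simps)
        finally show ?thesis .
      qed
      then show "\<exists>n'\<ge>L. \<exists>p'::int. \<forall>t\<in>{0..1}. f ((of_int p + t) / 2 ^ n) = (of_int p' + t) / 2 ^ n'"
        using n'(2) by blast
    qed
  qed
qed

section \<open>Homeomorphisms conjugating the doubling map\<close>

text \<open>\<open>H\<close> stands for a lift of the circle homeomorphism; the last two assumptions
  concern lifts of the two conjugates of \<open>nu2\<close>.\<close>

locale doubling_conjugacy =
  fixes H G :: "real \<Rightarrow> real"
  assumes H_mono: "strict_mono H"
    and HG: "H (G y) = y" and GH: "G (H x) = x"
    and H_shift: "H (x + 1) = H x + 1"
    and H_dyadic: "x \<in> dyadic_reals \<Longrightarrow> H x \<in> dyadic_reals"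
    and G_dyadic: "x \<in> dyadic_reals \<Longrightarrow> G x \<in> dyadic_reals"
    and PL_F: "dyadic_PL (\<lambda>y. H (2 * G y))"
    and PL_E: "dyadic_PL (\<lambda>x. G (2 * H x))"
begin

lemma G_mono: "strict_mono G"
proof (rule strict_monoI)
  fix x y :: real assume "x < y"
  then have "H (G x) < H (G y)"
    by (simp add: HG)
  then show "G x < G y"
    using H_mono by (simp add: strict_mono_less)
qed

lemma H_shift_int: "H (x + of_int i) = H x + of_int i"
  using H_shift by (rule shift_of_int)

lemma G_shift_int: "G (y + of_int i) = G y + of_int i"
proof -
  have "H (G y + of_int i) = y + of_int i"
    by (simp only: H_shift_int HG)
  then show ?thesis
    by (metis GH)
qed

section \<open>Similarity of the graph of \<open>H\<close> over two cells\<close>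

definition similar :: "nat \<Rightarrow> int \<Rightarrow> nat \<Rightarrow> int \<Rightarrow> bool"
  where "similar n p n' p' \<longleftrightarrow> (\<exists>k::int. \<exists>b. \<forall>t\<in>{0..1}.
    H ((of_int p' + t) / 2 ^ n') = 2 powi k * H ((of_int p + t) / 2 ^ n) + b)"

lemma similar_sym:
  assumes "similar n p n' p'"
  shows "similar n' p' n p"
proof -
  obtain k :: int and b where *: "\<And>t. t \<in> {0..1} \<Longrightarrow>
      H ((of_int p' + t) / 2 ^ n') = 2 powi k * H ((of_int p + t) / 2 ^ n) + b"
    using assms unfolding similar_def by blast
  have "H ((of_int p + t) / 2 ^ n) = 2 powi (- k) * H ((of_int p' + t) / 2 ^ n') + (- b / 2 powi k)"
    if "t \<in> {0..1}" for t
    using *[OF that] by (simp add: power_int_minus field_simps)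
  then show ?thesis
    unfolding similar_def by blast
qed

lemma similar_trans:
  assumes "similar n p n' p'" "similar n' p' n'' p''"
  shows "similar n p n'' p''"
proof -
  obtain k :: int and b where *: "\<And>t. t \<in> {0..1} \<Longrightarrow>
      H ((of_int p' + t) / 2 ^ n') = 2 powi k * H ((of_int p + t) / 2 ^ n) + b"
    using assms(1) unfolding similar_def by blast
  obtain k' :: int and b' where **: "\<And>t. t \<in> {0..1} \<Longrightarrow>
      H ((of_int p'' + t) / 2 ^ n'') = 2 powi k' * H ((of_int p' + t) / 2 ^ n') + b'"
    using assms(2) unfolding similar_def by blast
  have "H ((of_int p'' + t) / 2 ^ n'') =
      2 powi (k' + k) * H ((of_int p + t) / 2 ^ n) + (2 powi k' * b + b')"
    if "t \<in> {0..1}" for t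
    using *[OF that] **[OF that] by (simp add: power_int_add algebra_simps)
  then show ?thesis
    unfolding similar_def by blast
qed

text \<open>Passing from \<open>p\<close> to \<open>p * 2 ^ m + v\<close> appends \<open>m\<close>
  binary digits to the index, that is, selects a subcell. The affine relation is restricted to
  corresponding subcells.\<close>

lemma similar_subcell:
  assumes "similar n p n' p'" "0 \<le> v" "v < 2 ^ m"
  shows "similar (n + m) (p * 2 ^ m + v) (n' + m) (p' * 2 ^ m + v)"
proof -
  obtain k :: int and b where *: "\<And>t. t \<in> {0..1} \<Longrightarrow>
      H ((of_int p' + t) / 2 ^ n') = 2 powi k * H ((of_int p + t) / 2 ^ n) + b"
    using assms(1) unfolding similar_def by blast
  have "H ((of_int (p' * 2 ^ m + v) + t) / 2 ^ (n' + m)) =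
      2 powi k * H ((of_int (p * 2 ^ m + v) + t) / 2 ^ (n + m)) + b" if t: "t \<in> {0..1}" for t
  proof -
    define s where "s = (of_int v + t) / 2 ^ m"
    have "of_int v + t \<le> of_int (v + 1)"
      using t by simp
    also have "\<dots> \<le> (of_int (2 ^ m) :: real)"
      using assms(3) by (subst of_int_le_iff) simp
    finally have "s \<in> {0..1}"
      using t assms(2) by (simp add: s_def divide_le_eq)
    moreover have "(of_int (q * 2 ^ m + v) + t) / 2 ^ (l + m) = (of_int q + s) / 2 ^ l" for q l
      by (simp add: s_def power_add field_simps)
    ultimately show ?thesis
      using *[of s] by presburger
  qed
  then show ?thesis
    unfolding similar_def by blast
qed

text \<open>Doubling turns the cell \<open>(n + 1, p)\<close> into \<open>(n, p)\<close>, and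
  \<open>H (2 * x) = F (H x)\<close> with \<open>F y = H (2 * G y)\<close>. For large
  \<open>n\<close>, \<open>H\<close> maps the smaller cell into one cell on which \<open>F\<close>
  is affine.\<close>

lemma similar_double: "\<exists>N. \<forall>n\<ge>N. \<forall>p. similar (Suc n) p n p"
proof -
  obtain M where M: "\<And>p. \<exists>j::int. \<exists>b. \<forall>y\<in>cell M p. H (2 * G y) = 2 powi j * y + b"
    using PL_F unfolding dyadic_PL_def by blast
  have "\<exists>B. \<forall>q::int. G (of_int q / 2 ^ M) * 2 ^ B \<in> \<int>"
  proof (rule uniform_denominator)
    fix q :: int
    have "(of_int (q + 2 ^ M) :: real) / 2 ^ M = of_int q / 2 ^ M + of_int 1"
      by (simp add: field_simps)
    then show "G (of_int (q + 2 ^ M) / 2 ^ M) = G (of_int q / 2 ^ M) + of_int 1"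
      using G_shift_int by presburger
  qed (use G_dyadic dyadic_realsI in auto)
  then obtain B where B: "\<And>q::int. G (of_int q / 2 ^ M) * 2 ^ B \<in> \<int>"
    by blast
  show ?thesis
  proof (rule exI[of _ B], intro allI impI)
    fix n and p :: int assume n: "B \<le> n"
    obtain q where q: "H ` cell (Suc n) p \<subseteq> cell M q"
      using fine_cells[of H G M B "Suc n" p] H_mono HG B n by auto
    obtain j :: int and b where jb: "\<And>y. y \<in> cell M q \<Longrightarrow> H (2 * G y) = 2 powi j * y + b"
      using M by blast
    have "H ((of_int p + t) / 2 ^ n) = 2 powi j * H ((of_int p + t) / 2 ^ Suc n) + b"
      if "t \<in> {0..1}" for t
    proof -
      have "(of_int p + t) / 2 ^ Suc n \<in> cell (Suc n) p"
        using that by (auto simp: cell_param)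
      then have "H (2 * G (H ((of_int p + t) / 2 ^ Suc n))) = 2 powi j * H ((of_int p + t) / 2 ^ Suc n) + b"
        using q jb by blast
      moreover have "2 * ((of_int p + t) / 2 ^ Suc n) = (of_int p + t) / 2 ^ n"
        by (simp add: field_simps)
      ultimately show ?thesis
        by (simp only: GH)
    qed
    then show "similar (Suc n) p n p"
      unfolding similar_def by blast
  qed
qed

text \<open>Doubling brings every small cell to level \<open>N\<close> with its index unchanged.
  There, indices congruent modulo \<open>2 ^ N\<close> belong to integer translates, over which
  \<open>H\<close> differs by an integer.\<close>

lemma similar_if_cong: "\<exists>N. \<forall>n\<ge>N. \<forall>n'\<ge>N. \<forall>p p'. p mod 2 ^ N = p' mod 2 ^ N \<longrightarrow> similar n p n' p'"
proof -
  obtain N where N: "\<And>n p. n \<ge> N \<Longrightarrow> similar (Suc n) p n p"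
    using similar_double by blast
  have refl: "similar N p N p" for p
    unfolding similar_def by (intro exI[of _ 0]) simp
  have down: "similar n p N p" if "n \<ge> N" for n p
    using that
  proof (induction n rule: dec_induct)
    case base
    show ?case by (rule refl)
  next
    case (step n)
    then show ?case
      using N similar_trans by blast
  qed
  have level: "similar N p N p'" if cong: "p mod 2 ^ N = p' mod 2 ^ N" for p p'
  proof -
    obtain i where i: "p' = p + 2 ^ N * i"
      using cong by (metis mod_eqE mod_eq_dvd_iff dvd_def diff_add_cancel add.commute)
    have "H ((of_int p' + t) / 2 ^ N) = 2 powi 0 * H ((of_int p + t) / 2 ^ N) + of_int i" for t
    proof -
      have "(of_int p' + t) / 2 ^ N = (of_int p + t) / 2 ^ N + of_int i"
        by (simp add: i field_simps)
      then show ?thesis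
        using H_shift_int by simp
    qed
    then show ?thesis
      unfolding similar_def by blast
  qed
  have "similar n p n' p'" if "n \<ge> N" "n' \<ge> N" "p mod 2 ^ N = p' mod 2 ^ N" for n n' p p'
    using similar_trans[OF similar_trans[OF down level] similar_sym[OF down]] that by blast
  then show ?thesis
    by blast
qed

section \<open>Conjugates of dyadic translations\<close>

definition translate :: "nat \<Rightarrow> real \<Rightarrow> real"
  where "translate r x = G (H x + 1 / 2 ^ r)"

text \<open>Conjugation with doubling halves a shift:
  \<open>(2 * y + 1 / 2 ^ r) / 2 = y + 1 / 2 ^ Suc r\<close>, applied to
  \<open>y = H x\<close>.\<close>

lemma translate_Suc: "translate (Suc r) x = G (H (translate r (G (2 * H x))) / 2)"
  by (simp add: translate_def HG add_divide_distrib mult.commute)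

text \<open>Induction on \<open>r\<close>: translation by 1 preserves cells, and
  \<open>translate (Suc r)\<close> is \<open>translate r\<close> conjugated with \<open>E\<close>,
  where \<open>E\<close> and its inverse both preserve small cells.\<close>

lemma translate_preserves_small_cells: "preserves_small_cells (translate r)"
proof (induction r)
  case 0
  have "translate 0 = (\<lambda>x. x + 1)"
    using H_shift GH by (simp add: translate_def fun_eq_iff) (metis H_shift GH)
  moreover have "preserves_small_cells (\<lambda>x. x + 1)"
    unfolding preserves_small_cells_def
  proof
    fix L :: nat
    have "(of_int p + t) / 2 ^ n + 1 = (of_int (p + 2 ^ n) + t) / 2 ^ n" for p n and t :: real
      by (simp add: field_simps)
    then show "\<exists>m. \<forall>n\<ge>m. \<forall>p::int. \<exists>n'\<ge>L. \<exists>p'::int. \<forall>t\<in>{0..1::real}.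
        (of_int p + t) / 2 ^ n + 1 = (of_int p' + t) / 2 ^ n'"
      by blast
  qed
  ultimately show ?case by simp
next
  case (Suc r)
  define E where "E = (\<lambda>x. G (2 * H x))"
  define E' where "E' = (\<lambda>x. G (H x / 2))"
  have mono: "strict_mono E"
    using H_mono G_mono by (simp add: E_def strict_mono_def)
  have inv: "E (E' y) = y" "E' (E x) = x" for x y
    by (simp_all add: E_def E'_def HG GH)
  have per: "E (x + of_int 1) = E x + of_int 2" for x
    using G_shift_int[of "2 * H x" 2] by (simp add: E_def H_shift distrib_left)
  \<comment> \<open>\<open>E\<close> has degree 2, so its inverse repeats only after a shift by 2;
    hence the two numbers \<open>P\<close> and \<open>Q\<close> in the lemmas on
    \<open>dyadic_PL\<close>.\<close>
  have per': "E' (x + of_int 2) = E' x + of_int 1" for x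
    using inv per by metis
  have dy: "x \<in> dyadic_reals \<Longrightarrow> E x \<in> dyadic_reals" for x
    using G_dyadic H_dyadic dyadic_reals_mult[OF of_int_dyadic_reals[of 2]] by (simp add: E_def)
  have half: "1 / 2 \<in> dyadic_reals"
    using dyadic_realsI[of 1 1] by simp
  have dy': "x \<in> dyadic_reals \<Longrightarrow> E' x \<in> dyadic_reals" for x
    using G_dyadic H_dyadic dyadic_reals_mult[OF half] by (simp add: E'_def)
  have PL: "dyadic_PL E"
    using PL_E by (simp add: E_def)
  have "dyadic_PL E'"
    using dyadic_PL_inverse[of E E' 1 2] mono inv per dy PL by simp
  then have "preserves_small_cells E'"
    using dyadic_PL_preserves_small_cells[of E' 2 1] per' dy' by simp
  moreover have E: "preserves_small_cells E"
    using dyadic_PL_preserves_small_cells[of E 1 2] PL per dy by simp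
  moreover have "translate (Suc r) = (\<lambda>x. E' (translate r (E x)))"
    by (simp add: fun_eq_iff translate_Suc E_def E'_def)
  ultimately show ?case
    using preserves_small_cells_comp[OF preserves_small_cells_comp[OF E Suc], of E'] by simp
qed

text \<open>Going from level \<open>n + 1\<close> to level \<open>n\<close>: the images of the two halves of a cell are adjacent
  cells, the left one with an even and the right one with an odd index. This is only possible if
  they are the two halves of a cell.\<close>

lemma translate_descent:
  assumes parity: "\<And>n n' p p'. n \<ge> M \<Longrightarrow> n' \<ge> M \<Longrightarrow> similar n p n' p' \<Longrightarrow> even p \<longleftrightarrow> even p'"
    and fine: "\<And>n p n' p'. n \<ge> M \<Longrightarrow> cell n p \<subseteq> cell M 0 \<Longrightarrow>
      \<forall>t\<in>{0..1}. translate r ((of_int p + t) / 2 ^ n) = (of_int p' + t) / 2 ^ n' \<Longrightarrow> n' \<ge> M"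
    and M: "M > 0" and n: "n \<ge> M" and sub: "cell n p \<subseteq> cell M 0"
  shows "\<exists>n' (p'::int). \<forall>t\<in>{0..1}. translate r ((of_int p + t) / 2 ^ n) = (of_int p' + t) / 2 ^ n'"
proof -
  have "\<exists>m. \<forall>n\<ge>m. \<forall>p::int. \<exists>n'\<ge>0. \<exists>p'::int. \<forall>t\<in>{0..1}.
      translate r ((of_int p + t) / 2 ^ n) = (of_int p' + t) / 2 ^ n'"
    using translate_preserves_small_cells[of r] unfolding preserves_small_cells_def by (rule spec)
  then obtain m where m: "\<And>n p. n \<ge> m \<Longrightarrow>
      \<exists>n' (p'::int). \<forall>t\<in>{0..1}. translate r ((of_int p + t) / 2 ^ n) = (of_int p' + t) / 2 ^ n'"
    by blast
  \<comment> \<open>Downward induction from level \<open>n + m\<close>, where all cells are already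
    small enough.\<close>
  have "n \<le> n + m" by simp
  then show ?thesis
    using n sub
  proof (induction n arbitrary: p rule: inc_induct)
    case base
    then show ?case using m by simp
  next
    case (step n)
    have half: "\<exists>n' p'. n' \<ge> M \<and> (even p' \<longleftrightarrow> even q) \<and>
        (\<forall>t\<in>{0..1}. translate r ((of_int q + t) / 2 ^ Suc n) = (of_int p' + t) / 2 ^ n')"
      if q: "q = 2 * p \<or> q = 2 * p + 1" for q
    proof -
      have "cell (Suc n) q \<subseteq> cell n p"
        using q by (rule half_cell_subset)
      then have sub: "cell (Suc n) q \<subseteq> cell M 0"
        using step.prems by blast
      obtain n' p' where t: "\<forall>t\<in>{0..1}. translate r ((of_int q + t) / 2 ^ Suc n) = (of_int p' + t) / 2 ^ n'"
        using step.IH[of q] step.prems sub by auto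
      have n': "n' \<ge> M"
        using fine[OF _ sub t] step.prems by simp
      \<comment> \<open>A translate only adds a constant to \<open>H\<close>, so it maps cells to
        similar cells and \<open>parity\<close> applies.\<close>
      have "H ((of_int p' + t) / 2 ^ n') = 2 powi 0 * H ((of_int q + t) / 2 ^ Suc n) + 1 / 2 ^ r"
        if "t \<in> {0..1}" for t
      proof -
        have "H ((of_int p' + t) / 2 ^ n') = H (translate r ((of_int q + t) / 2 ^ Suc n))"
          using t that by simp
        then show ?thesis
          by (simp add: translate_def HG)
      qed
      then have "similar (Suc n) q n' p'"
        unfolding similar_def by blast
      then have "even p' \<longleftrightarrow> even q"
        using parity[of "Suc n" n' q p'] n' step.prems by simp
      then show ?thesis
        using n' t by blast
    qed
    obtain a p0 where a: "a \<ge> M" "even p0"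
      and t0: "\<forall>t\<in>{0..1}. translate r ((of_int (2 * p) + t) / 2 ^ Suc n) = (of_int p0 + t) / 2 ^ a"
      using half[of "2 * p"] by auto
    obtain b p1 where b: "b \<ge> M" "odd p1"
      and t1: "\<forall>t\<in>{0..1}. translate r ((of_int (2 * p + 1) + t) / 2 ^ Suc n) = (of_int p1 + t) / 2 ^ b"
      using half[of "2 * p + 1"] by auto
    \<comment> \<open>Both sides are the image of the midpoint. As \<open>p0 + 1\<close> and
      \<open>p1\<close> are odd, these are reduced fractions for the same number, so the
      denominators agree.\<close>
    have "(of_int p0 + 1) / 2 ^ a = (of_int p1 + 0 :: real) / 2 ^ b"
      using t0[rule_format, of 1] t1[rule_format, of 0] by simp
    then have "(of_int ((p0 + 1) * 2 ^ b) :: real) = of_int (p1 * 2 ^ a)"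
      by (simp add: field_simps)
    then have eq: "(p0 + 1) * 2 ^ b = p1 * 2 ^ a"
      by (simp only: of_int_eq_iff)
    have ab: "a = b"
    proof (rule ccontr)
      assume "a \<noteq> b"
      then consider "a < b" | "b < a" by linarith
      then show False
      proof cases
        case 1
        then have "(2::int) ^ b = 2 ^ a * 2 ^ (b - a)"
          by (simp flip: power_add)
        then have "(p0 + 1) * 2 ^ (b - a) = p1"
          using eq by simp
        then show False
          using b 1 by auto
      next
        case 2
        then have "(2::int) ^ a = 2 ^ b * 2 ^ (a - b)"
          by (simp flip: power_add)
        then have "p0 + 1 = p1 * 2 ^ (a - b)"
          using eq by simp
        then show False
          using a 2 by (metis even_mult_iff even_power even_add odd_one even_numeral zero_less_diff)
      qed
    qed
    then have p1: "p1 = p0 + 1"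
      using eq by simp
    obtain c where c: "a = Suc c"
      using a M by (cases a) auto
    obtain p' where p': "p0 = 2 * p'"
      using a by blast
    have "translate r ((of_int p + t) / 2 ^ n) = (of_int p' + t) / 2 ^ c" if t: "t \<in> {0..1}" for t
    proof (cases "t \<le> 1 / 2")
      case True
      have "(of_int p + t) / 2 ^ n = (of_int (2 * p) + 2 * t) / 2 ^ Suc n"
        by (simp add: field_simps)
      then have "translate r ((of_int p + t) / 2 ^ n) = (of_int p0 + 2 * t) / 2 ^ a"
        using t0[rule_format, of "2 * t"] t True by simp
      then show ?thesis
        by (simp add: p' c field_simps)
    next
      case False
      have "(of_int p + t) / 2 ^ n = (of_int (2 * p + 1) + (2 * t - 1)) / 2 ^ Suc n"
        by (simp add: field_simps)
      then have "translate r ((of_int p + t) / 2 ^ n) = (of_int p1 + (2 * t - 1)) / 2 ^ b"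
        using t1[rule_format, of "2 * t - 1"] t False by simp
      then show ?thesis
        by (simp add: p' c p1 ab[symmetric] field_simps)
    qed
    then show ?case by blast
  qed
qed

text \<open>By the descent, a translate that moves the leftmost cell by less than its length would
  map it onto a cell that overlaps it without being nested with it.\<close>

lemma parity_not_determined:
  "\<not> (\<forall>n\<ge>M. \<forall>n'\<ge>M. \<forall>p p'. similar n p n' p' \<longrightarrow> (even p \<longleftrightarrow> even p'))"
proof
  assume "\<forall>n\<ge>M. \<forall>n'\<ge>M. \<forall>p p'. similar n p n' p' \<longrightarrow> (even p \<longleftrightarrow> even p')"
  \<comment> \<open>Level \<open>Suc M\<close> is positive, as the descent requires.\<close>
  then have parity: "\<And>n n' p p'. n \<ge> Suc M \<Longrightarrow> n' \<ge> Suc M \<Longrightarrow> similar n p n' p' \<Longrightarrow> even p \<longleftrightarrow> even p'"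
    by (metis Suc_leD)
  define b :: real where "b = 1 / 2 ^ Suc M"
  have "b > 0"
    by (simp add: b_def)
  have "0 < min (H b - H 0) (H (2 * b) - H b)"
    using H_mono \<open>b > 0\<close> by (simp add: strict_mono_less)
  \<comment> \<open>The shift \<open>1 / 2 ^ r\<close> is below the increments of \<open>H\<close>
    over \<open>{0..b}\<close> and \<open>{b..2 * b}\<close>, so \<open>0\<close> and
    \<open>b\<close> both move to the right by less than \<open>b\<close>.\<close>
  then obtain r :: nat where r: "(1 / 2) ^ r < min (H b - H 0) (H (2 * b) - H b)"
    using real_arch_pow_inv[of "min (H b - H 0) (H (2 * b) - H b)" "1/2"] by auto
  have s0: "0 < translate r 0" "translate r 0 < b"
  proof -
    have "H 0 < H (translate r 0)" "H (translate r 0) < H b"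
      using r by (auto simp: translate_def HG power_one_over)
    then show "0 < translate r 0" "translate r 0 < b"
      using H_mono by (simp_all add: strict_mono_less)
  qed
  have sb: "b < translate r b" "translate r b < 2 * b"
  proof -
    have "H b < H (translate r b)" "H (translate r b) < H (2 * b)"
      using r by (auto simp: translate_def HG power_one_over)
    then show "b < translate r b" "translate r b < 2 * b"
      using H_mono by (simp_all add: strict_mono_less)
  qed
  have mono: "translate r x \<le> translate r y" if "x \<le> y" for x y
    using that H_mono G_mono by (simp add: translate_def strict_mono_less_eq)
  have cell0: "cell (Suc M) 0 = {0..b}"
    by (simp add: cell_def b_def)
  \<comment> \<open>The image of a cell inside \<open>{0..b}\<close> lies strictly between
    \<open>0\<close> and \<open>2 * b = 1 / 2 ^ M\<close>, so its level exceeds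
    \<open>M\<close>.\<close>
  have fine: "n' \<ge> Suc M" if n: "n \<ge> Suc M" and sub: "cell n p \<subseteq> cell (Suc M) 0"
    and t: "\<forall>t\<in>{0..1}. translate r ((of_int p + t) / 2 ^ n) = (of_int p' + t) / 2 ^ n'" for n p n' p'
  proof -
    have in_cell: "(of_int p + t) / 2 ^ n \<in> {0..b}" if "t \<in> {0..1}" for t
      using that sub cell_param unfolding cell0 by blast
    have "(of_int p' + 0 :: real) / 2 ^ n' \<ge> translate r 0"
      using mono[of 0 "(of_int p + 0) / 2 ^ n"] in_cell[of 0] t[rule_format, of 0] by simp
    moreover have "(of_int p' + 1 :: real) / 2 ^ n' \<le> translate r b"
      using mono[of "(of_int p + 1) / 2 ^ n" b] in_cell[of 1] t[rule_format, of 1] by simp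
    ultimately have "1 / 2 ^ n' < 2 * b"
      using s0 sb by (simp add: add_divide_distrib)
    then have "(2::real) ^ M < 2 ^ n'"
      by (simp add: b_def field_simps)
    then show ?thesis
      by (simp add: Suc_le_eq)
  qed
  obtain n' p' where t: "\<forall>t\<in>{0..1}. translate r ((of_int 0 + t) / 2 ^ Suc M) = (of_int p' + t) / 2 ^ n'"
  proof -
    have "\<exists>n' (p'::int). \<forall>t\<in>{0..1}. translate r ((of_int 0 + t) / 2 ^ Suc M) = (of_int p' + t) / 2 ^ n'"
    proof (rule translate_descent[where M = "Suc M" and n = "Suc M" and p = 0])
      show "even p \<longleftrightarrow> even p'" if "n \<ge> Suc M" "n' \<ge> Suc M" "similar n p n' p'" for n n' p p'
        using that by (rule parity)
      show "n' \<ge> Suc M" if "n \<ge> Suc M" "cell n p \<subseteq> cell (Suc M) 0"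
        "\<forall>t\<in>{0..1}. translate r ((of_int p + t) / 2 ^ n) = (of_int p' + t) / 2 ^ n'" for n p n' p'
        using that by (rule fine)
    qed auto
    then show ?thesis
      using that by blast
  qed
  have n': "n' \<ge> Suc M"
    using fine[OF order_refl order_refl t] .
  have e0: "translate r 0 = of_int p' / 2 ^ n'"
    using t[rule_format, of 0] by simp
  have eb: "translate r b = (of_int p' + 1) / 2 ^ n'"
    using t[rule_format, of 1] by (simp add: b_def)
  \<comment> \<open>\<open>b\<close> is a grid point of level \<open>n'\<close>. The image cell
    starts to the left of \<open>b\<close>, so it ends at \<open>b\<close> at the latest, against
    \<open>b < translate r b\<close>.\<close>
  define i where "i = n' - Suc M"
  have pow: "(2::real) ^ n' = 2 ^ i * 2 ^ Suc M"
    using n' by (simp only: i_def flip: power_add) simp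
  have "of_int p' < (2 ^ i :: real)"
    using s0(2) unfolding e0 b_def pow by (simp add: field_simps)
  then have "of_int p' < (of_int (2 ^ i) :: real)"
    by simp
  then have "p' < 2 ^ i"
    by (simp only: of_int_less_iff)
  then have "p' + 1 \<le> 2 ^ i"
    by simp
  then have "of_int (p' + 1) \<le> (of_int (2 ^ i) :: real)"
    by (simp only: of_int_le_iff)
  then have "(of_int p' + 1) / 2 ^ n' \<le> (2 ^ i :: real) / 2 ^ n'"
    by (intro divide_right_mono) simp_all
  also have "\<dots> = b"
    by (simp add: b_def pow)
  finally have "translate r b \<le> b"
    by (simp only: eb)
  then show False
    using sb by simp
qed

text \<open>The least \<open>k\<close> such that the last \<open>k\<close> binary digits of the index determine the similarity
  class of a small cell is 0: otherwise similarity would determine the last digit.\<close>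

lemma all_small_cells_similar: "\<exists>M. \<forall>n\<ge>M. \<forall>n'\<ge>M. \<forall>p p'. similar n p n' p'"
proof -
  define W where "W k \<longleftrightarrow> (\<exists>M. \<forall>n\<ge>M. \<forall>n'\<ge>M. \<forall>p p'. p mod 2 ^ k = p' mod 2 ^ k \<longrightarrow> similar n p n' p')" for k :: nat
  have "\<exists>k. W k"
    using similar_if_cong unfolding W_def by blast
  define k where "k = (LEAST k. W k)"
  have "W k"
    unfolding k_def using \<open>\<exists>k. W k\<close> by (rule LeastI_ex)
  then obtain M where M: "\<And>n n' p p'. n \<ge> M \<Longrightarrow> n' \<ge> M \<Longrightarrow> p mod 2 ^ k = p' mod 2 ^ k \<Longrightarrow> similar n p n' p'"
    unfolding W_def by blast
  have "k = 0"
  proof (rule ccontr)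
    assume "k \<noteq> 0"
    then obtain l where k: "k = Suc l"
      using not0_implies_Suc by blast
    then have "\<not> W l"
      unfolding k_def using not_less_Least[of l W] by (simp add: k_def)
    \<comment> \<open>By minimality of \<open>k\<close>, the bound \<open>M\<close> fails for
      \<open>l\<close> digits: two dissimilar cells share their last \<open>l\<close> digits. By the
      choice of \<open>M\<close> they differ in the preceding digit.\<close>
    then obtain n1 n2 p1 p2 where 1: "n1 \<ge> M" "n2 \<ge> M" "p1 mod 2 ^ l = p2 mod 2 ^ l"
      and not: "\<not> similar n1 p1 n2 p2"
      unfolding W_def by blast
    define v where "v = p1 mod 2 ^ l"
    have v: "0 \<le> v" "v < 2 ^ l"
      by (simp_all add: v_def)
    have res: "p mod 2 ^ k = (p div 2 ^ l mod 2) * 2 ^ l + p mod 2 ^ l" for p :: int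
      using zmod_zmult2_eq[of 2 p "2 ^ l"] unfolding k by (simp add: mult.commute)
    have diff: "(p1 div 2 ^ l) mod 2 \<noteq> (p2 div 2 ^ l) mod 2"
      using M[OF 1(1,2), of p1 p2] not res[of p1] res[of p2] 1(3) by auto
    have sub: "(p * 2 ^ l + v) mod 2 ^ k = (p mod 2) * 2 ^ l + v" for p
      using res[of "p * 2 ^ l + v"] v by simp
    \<comment> \<open>If similar cells had indices of different parity, appending the digits
      \<open>v\<close> to both would give similar cells whose last \<open>k\<close> digits are those
      of \<open>p1\<close> and \<open>p2\<close>, in one order or the other. Then the two dissimilar
      cells would be similar.\<close>
    have "even p \<longleftrightarrow> even p'" if n: "n \<ge> M" "n' \<ge> M" and sim: "similar n p n' p'" for n n' p p'
    proof (rule ccontr)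
      assume odd: "\<not> (even p \<longleftrightarrow> even p')"
      have s: "similar (n + l) (p * 2 ^ l + v) (n' + l) (p' * 2 ^ l + v)"
        using similar_subcell[OF sim v] .
      have e1: "similar n1 p1 m (q * 2 ^ l + v)" if "m \<ge> M" "q mod 2 = p1 div 2 ^ l mod 2" for m q
        using that 1 by (intro M) (simp_all add: res[of p1] sub, simp_all add: v_def)
      have e2: "similar m (q * 2 ^ l + v) n2 p2" if "m \<ge> M" "q mod 2 = p2 div 2 ^ l mod 2" for m q
        using that 1 by (intro M) (simp_all add: res[of p2] sub, simp_all add: v_def)
      have "p mod 2 = p1 div 2 ^ l mod 2 \<and> p' mod 2 = p2 div 2 ^ l mod 2 \<or>
        p' mod 2 = p1 div 2 ^ l mod 2 \<and> p mod 2 = p2 div 2 ^ l mod 2"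
        using diff odd unfolding even_iff_mod_2_eq_zero not_mod_2_eq_0_eq_1 by (metis mod2_eq_if)
      then have "similar n1 p1 n2 p2"
      proof
        assume "p mod 2 = p1 div 2 ^ l mod 2 \<and> p' mod 2 = p2 div 2 ^ l mod 2"
        then show ?thesis
          using e1[of "n + l" p] e2[of "n' + l" p'] s n similar_trans by (meson trans_le_add1)
      next
        assume "p' mod 2 = p1 div 2 ^ l mod 2 \<and> p mod 2 = p2 div 2 ^ l mod 2"
        then show ?thesis
          using e1[of "n' + l" p'] e2[of "n + l" p] similar_sym[OF s] n similar_trans by (meson trans_le_add1)
      qed
      then show False
        using not by simp
    qed
    then show False
      using parity_not_determined[of M] by blast
  qed
  then have "similar n p n' p'" if "n \<ge> M" "n' \<ge> M" for n n' p p'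
    using M[OF that, of p p'] by simp
  then show ?thesis
    by blast
qed

text \<open>The similarity factors of the two halves of a cell are powers of 2 with sum 1, so both
  are 1/2. The deviation of \<open>H\<close> from its chord is then halved by each bisection and
  vanishes. The slope is a power of 2 because it and its reciprocal are dyadic.\<close>

lemma H_affine_on_small_cells: "dyadic_PL H"
proof -
  obtain M where M: "\<And>n n' p p'. n \<ge> M \<Longrightarrow> n' \<ge> M \<Longrightarrow> similar n p n' p'"
    using all_small_cells_similar by blast
  have "\<exists>j::int. \<exists>b. \<forall>x\<in>cell M p. H x = 2 powi j * x + b" for p
  proof -
    define \<phi> where "\<phi> t = H ((of_int p + t) / 2 ^ M)" for t
    have \<phi>_mono: "s < t \<Longrightarrow> \<phi> s < \<phi> t" for s t
      using H_mono by (simp add: \<phi>_def strict_mono_less divide_strict_right_mono)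
    have left: "(of_int (2 * p) + t) / 2 ^ Suc M = (of_int p + t / 2) / 2 ^ M" for t :: real
      by (simp add: field_simps)
    have right: "(of_int (2 * p + 1) + t) / 2 ^ Suc M = (of_int p + (1 + t) / 2) / 2 ^ M" for t :: real
      by (simp add: field_simps)
    obtain k b where k: "\<And>t. t \<in> {0..1} \<Longrightarrow> \<phi> (t / 2) = 2 powi k * \<phi> t + b"
      using M[of M "Suc M" p "2 * p"] unfolding similar_def left \<phi>_def by auto
    obtain l c where l: "\<And>t. t \<in> {0..1} \<Longrightarrow> \<phi> ((1 + t) / 2) = 2 powi l * \<phi> t + c"
      using M[of M "Suc M" p "2 * p + 1"] unfolding similar_def right \<phi>_def by auto
    define len where "len = \<phi> 1 - \<phi> 0"
    have len: "len > 0"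
      using \<phi>_mono[of 0 1] by (simp add: len_def)
    have "\<phi> (1 / 2) - \<phi> 0 = 2 powi k * len"
      using k[of 0] k[of 1] by (simp add: len_def algebra_simps)
    moreover have "\<phi> 1 - \<phi> (1 / 2) = 2 powi l * len"
      using l[of 0] l[of 1] by (simp add: len_def algebra_simps)
    ultimately have "(2 powi k + 2 powi l) * len = 1 * len"
      by (simp add: len_def algebra_simps)
    then have sum: "2 powi k + 2 powi l = (1::real)"
      using len by (simp only: mult_right_cancel)
    \<comment> \<open>Powers of 2 below 1 are at most 1/2, so sum 1 forces equality. This is where
      it matters that \<open>similar\<close> admits only powers of 2 as factors.\<close>
    have kl: "k = - 1 \<and> l = - 1"
    proof -
      have pos: "(2::real) powi i > 0" for i
        by simp
      have small: "(2::real) powi i \<le> 1 / 2" if "(2::real) powi i < 1" for i :: int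
      proof -
        have "i < 0"
        proof (rule ccontr)
          assume "\<not> i < 0"
          then have "(2::real) powi i \<ge> 1"
            by (simp add: one_le_power_int)
          then show False
            using that by simp
        qed
        then have "(2::real) powi i \<le> 2 powi (- 1)"
          by (intro power_int_increasing) auto
        then show ?thesis
          by simp
      qed
      have "2 powi k < (1::real)" "2 powi l < (1::real)"
        using sum pos[of k] pos[of l] by linarith+
      then have "(2::real) powi k = 2 powi (- 1)" "(2::real) powi l = 2 powi (- 1)"
        using small[of k] small[of l] sum by simp_all
      then show ?thesis
        by (simp only: powi_two_inject)
    qed
    have kb: "\<phi> (t / 2) - \<phi> 0 = (\<phi> t - \<phi> 0) / 2" if "t \<in> {0..1}" for t
      using k[OF that] k[of 0] kl by simp
    have lc: "\<phi> 1 - \<phi> ((1 + t) / 2) = (\<phi> 1 - \<phi> t) / 2" if "t \<in> {0..1}" for t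
      using l[OF that] l[of 1] kl by simp
    \<comment> \<open>The deviation from the chord. Its value at \<open>t\<close> is half of its
      value at \<open>2 * t\<close> or at \<open>2 * t - 1\<close>; iteration gives the bound
      \<open>len / 2 ^ m\<close>.\<close>
    define \<psi> where "\<psi> t = \<phi> t - \<phi> 0 - t * len" for t
    have bound: "\<bar>\<psi> t\<bar> \<le> len / 2 ^ m" if "t \<in> {0..1}" for t m
      using that
    proof (induction m arbitrary: t)
      case 0
      have "\<phi> 0 \<le> \<phi> t" "\<phi> t \<le> \<phi> 1"
        using \<phi>_mono[of 0 t] \<phi>_mono[of t 1] 0 by (cases "t = 0"; cases "t = 1"; force)+
      moreover have "0 \<le> t * len" "t * len \<le> len"
        using 0 len by (simp_all add: mult_left_le_one_le)
      ultimately show ?case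
        by (auto simp: \<psi>_def len_def)
    next
      case (Suc m)
      have "\<exists>s\<in>{0..1}. \<psi> t = \<psi> s / 2"
      proof (cases "t \<le> 1 / 2")
        case True
        then show ?thesis
          using kb[of "2 * t"] Suc.prems by (intro bexI[of _ "2 * t"]) (auto simp: \<psi>_def field_simps)
      next
        case False
        then show ?thesis
          using lc[of "2 * t - 1"] Suc.prems
          by (intro bexI[of _ "2 * t - 1"]) (auto simp: \<psi>_def len_def field_simps)
      qed
      then obtain s where "s \<in> {0..1}" "\<psi> t = \<psi> s / 2"
        by blast
      then show ?case
        using Suc.IH[of s] by simp
    qed
    have affine: "\<phi> t = \<phi> 0 + t * len" if t: "t \<in> {0..1}" for t
    proof (rule ccontr)
      assume "\<phi> t \<noteq> \<phi> 0 + t * len"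
      then have "0 < \<bar>\<psi> t\<bar> / len"
        using len by (simp add: \<psi>_def)
      then obtain m :: nat where "(1 / 2) ^ m < \<bar>\<psi> t\<bar> / len"
        using real_arch_pow_inv[of "\<bar>\<psi> t\<bar> / len" "1/2"] by auto
      then have "len / 2 ^ m < \<bar>\<psi> t\<bar>"
        using len by (simp add: power_one_over field_simps)
      then show False
        using bound[OF t, of m] by simp
    qed
    define \<sigma> where "\<sigma> = len * 2 ^ M"
    have \<sigma>: "\<sigma> > 0"
      using len by (simp add: \<sigma>_def)
    have H_eq: "H x = \<sigma> * x + (\<phi> 0 - of_int p * len)" if x: "x \<in> cell M p" for x
    proof -
      obtain t where t: "t \<in> {0..1}" "x = (of_int p + t) / 2 ^ M"
        using cell_param[THEN iffD1, OF x] by (elim bexE)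
      then have "H x = \<phi> 0 + t * len"
        using affine[of t] by (simp add: \<phi>_def)
      moreover have "2 ^ M * x = of_int p + t"
        by (simp add: t(2))
      then have "\<sigma> * x = len * (of_int p + t)"
        by (simp only: \<sigma>_def mult.assoc)
      ultimately show ?thesis
        by (simp add: algebra_simps)
    qed
    have ends: "\<phi> 0 \<in> dyadic_reals" "\<phi> 1 \<in> dyadic_reals"
      using H_dyadic[OF dyadic_realsI, of p M] H_dyadic[OF dyadic_realsI, of "p + 1" M]
      by (simp_all add: \<phi>_def)
    have "\<sigma> \<in> dyadic_reals"
      unfolding \<sigma>_def len_def using ends of_int_dyadic_reals[of "2 ^ M"]
      by (intro dyadic_reals_mult dyadic_reals_diff) simp_all
    moreover have "1 / \<sigma> \<in> dyadic_reals"
    proof -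
      obtain i :: nat where i: "(1 / 2) ^ i < len"
        using real_arch_pow_inv[of len "1/2"] len by auto
      \<comment> \<open>The parameter at which \<open>\<phi>\<close> has grown by exactly
        \<open>1 / 2 ^ i\<close>; the choice of \<open>i\<close> ensures \<open>t \<le> 1\<close>.
        The point is dyadic, being a value of \<open>G\<close> at a dyadic number, and
        \<open>2 ^ i * t / 2 ^ M\<close> is \<open>1 / \<sigma>\<close>.\<close>
      define t where "t = 1 / (2 ^ i * len)"
      have t: "t \<in> {0..1}"
        using i len by (simp add: t_def power_one_over field_simps)
      have "H ((of_int p + t) / 2 ^ M) = \<phi> 0 + 1 / 2 ^ i"
        using affine[OF t] len by (simp add: \<phi>_def t_def)
      then have "(of_int p + t) / 2 ^ M = G (\<phi> 0 + 1 / 2 ^ i)"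
        by (metis GH)
      also have "\<dots> \<in> dyadic_reals"
        using ends dyadic_realsI[of 1 i] by (intro G_dyadic dyadic_reals_add) simp_all
      finally have "(of_int p + t) / 2 ^ M - of_int p / 2 ^ M \<in> dyadic_reals"
        by (rule dyadic_reals_diff) (rule dyadic_realsI)
      then have "((of_int p + t) / 2 ^ M - of_int p / 2 ^ M) * of_int (2 ^ i) \<in> dyadic_reals"
        by (rule dyadic_reals_mult) (rule of_int_dyadic_reals)
      moreover have "((of_int p + t) / 2 ^ M - of_int p / 2 ^ M) * of_int (2 ^ i) = 1 / \<sigma>"
        using len by (simp add: t_def \<sigma>_def add_divide_distrib)
      ultimately show ?thesis
        by simp
    qed
    ultimately obtain j :: int where "\<sigma> = 2 powi j"
      using dyadic_unit_powi \<sigma> by blast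
    then show ?thesis
      using H_eq by blast
  qed
  then show ?thesis
    unfolding dyadic_PL_def by blast
qed

end

section \<open>Lifts of piecewise linear maps of the circle\<close>

lemma to_circle_eq_iff: "to_circle x = to_circle y \<longleftrightarrow> x - y \<in> \<int>"
  using circle.abs_eq_iff .

lemma to_circle_surj: "\<exists>t. to_circle t = x"
  by (metis Quotient3_circle Quotient3_def)

lemma to_circle_add_int [simp]: "to_circle (x + of_int i) = to_circle x"
  by (simp add: to_circle_eq_iff)

lemma nu2_to_circle [simp]: "nu2 (to_circle x) = to_circle (2 * x)"
  by (rule nu2.abs_eq)

lemma open_circle_iff: "open (U :: circle set) \<longleftrightarrow> open (to_circle -` U)"
  by (rule open_circle_def)

text \<open>The preimage of the image is the union of all integer translates of
  \<open>S\<close>.\<close>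

lemma open_to_circle_image:
  assumes "open S"
  shows "open (to_circle ` S)"
proof -
  have "to_circle -` to_circle ` S = (\<Union>i::int. (\<lambda>x. x + of_int i) ` S)"
  proof (intro equalityI subsetI)
    fix x assume "x \<in> to_circle -` to_circle ` S"
    then obtain s where s: "s \<in> S" "x - s \<in> \<int>"
      by (auto simp: to_circle_eq_iff)
    then obtain i where "x = s + of_int i"
      by (metis Ints_cases add.commute diff_add_cancel)
    then show "x \<in> (\<Union>i::int. (\<lambda>x. x + of_int i) ` S)"
      using s by blast
  qed auto
  moreover have "open (\<Union>i::int. (\<lambda>x. x + of_int i) ` S)"
    using assms by (intro open_UN ballI open_translation_subtract[of S "- of_int _", simplified])
  ultimately show ?thesis
    by (simp add: open_circle_iff)
qed

lemma powi_dyadic_reals: "of_int a * 2 powi b \<in> dyadic_reals"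
  by (intro dyadic_reals_mult of_int_dyadic_reals powi_two_dyadic_reals)

lemma dyadic_real_powi:
  assumes "x \<in> dyadic_reals"
  shows "\<exists>(a::int) (b::int). x = of_int a * 2 powi b"
proof -
  obtain a :: int and n where "x = of_int a / 2 ^ n"
    using assms by (elim dyadic_realsE)
  then have "x = of_int a * 2 powi (- int n)"
    by (simp add: power_int_minus divide_inverse)
  then show ?thesis by blast
qed

lemma to_circle_in_dyadic_iff: "to_circle x \<in> dyadic \<longleftrightarrow> x \<in> dyadic_reals"
proof
  assume "to_circle x \<in> dyadic"
  then obtain a b :: int where "x - of_int a * 2 powi b \<in> \<int>"
    by (auto simp: dyadic_def to_circle_eq_iff)
  then have "(x - of_int a * 2 powi b) + of_int a * 2 powi b \<in> dyadic_reals"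
    by (intro dyadic_reals_add powi_dyadic_reals) (rule Ints_dyadic_reals)
  then show "x \<in> dyadic_reals"
    by simp
next
  assume "x \<in> dyadic_reals"
  then show "to_circle x \<in> dyadic"
    using dyadic_real_powi by (fastforce simp: dyadic_def)
qed

text \<open>Meant for the difference of two continuous lifts of the same map.\<close>

lemma eventually_const_if_Ints:
  fixes d :: "real \<Rightarrow> real"
  assumes "isCont d t" "\<forall>\<^sub>F s in nhds t. d s \<in> \<int>"
  shows "\<forall>\<^sub>F s in nhds t. d s = d t"
proof -
  have "d t \<in> \<int>"
    using assms(2) by (rule eventually_nhds_x_imp_x)
  have "(d \<longlongrightarrow> d t) (nhds t)"
    using assms(1) by (simp add: isCont_def tendsto_at_iff_tendsto_nhds)
  then have "\<forall>\<^sub>F s in nhds t. dist (d s) (d t) < 1"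
    by (rule tendstoD) simp
  then show ?thesis
    using assms(2)
  proof eventually_elim
    case (elim s)
    then have "d s - d t \<in> \<int>" "\<bar>d s - d t\<bar> < 1"
      using \<open>d t \<in> \<int>\<close> by (auto simp: dist_real_def)
    then show ?case
      by (metis Ints_nonzero_abs_less1 eq_iff_diff_eq_0)
  qed
qed

section \<open>Slopes and linearity in terms of a global lift\<close>

lemma has_slope_lift:
  assumes lift: "\<And>s. f (to_circle s) = to_circle (F s)" and cont: "\<And>t. isCont F t"
    and per: "\<And>s i. F (s + of_int i) = F s + of_int (d * i)"
    and slope: "has_slope f (to_circle t) m"
  shows "(F has_real_derivative m) (at t)"
proof -
  obtain t' F' where t': "to_circle t' = to_circle t"
    and F': "\<forall>\<^sub>F s in nhds t'. f (to_circle s) = to_circle (F' s)"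
    and der: "(F' has_real_derivative m) (at t')"
    using slope unfolding has_slope_def by blast
  \<comment> \<open>\<open>F'\<close> is a lift near the representative \<open>t'\<close> only. Its
    difference from \<open>F\<close> is integer-valued there and continuous at \<open>t'\<close>,
    hence constant near \<open>t'\<close>.\<close>
  have "\<forall>\<^sub>F s in nhds t'. F s - F' s = F t' - F' t'"
  proof (rule eventually_const_if_Ints)
    show "isCont (\<lambda>s. F s - F' s) t'"
      using cont DERIV_isCont[OF der] by (intro continuous_intros) auto
    show "\<forall>\<^sub>F s in nhds t'. F s - F' s \<in> \<int>"
      using F' by eventually_elim (simp add: lift to_circle_eq_iff)
  qed
  then have ev: "\<forall>\<^sub>F s in nhds t'. F s = F' s + (F t' - F' t')"
    by eventually_elim simp
  have "((\<lambda>s. F' s + (F t' - F' t')) has_real_derivative m) (at t')"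
    using DERIV_add[OF der DERIV_const[of "F t' - F' t'"]] by simp
  then have dF: "(F has_real_derivative m) (at t')"
    using DERIV_cong_ev[OF refl ev refl] by blast
  \<comment> \<open>Quasi-periodicity of \<open>F\<close> moves the derivative from
    \<open>t'\<close> to \<open>t\<close>. Here \<open>d\<close> is the degree: 1 for the
    homeomorphism, 2 for the conjugates of \<open>nu2\<close>.\<close>
  obtain i :: int where i: "t = t' + of_int i"
    using t' by (metis Ints_cases add.commute diff_add_cancel to_circle_eq_iff)
  have "((\<lambda>s. F (s + of_int (- i))) has_real_derivative m) (at t)"
    using dF DERIV_shift[of F m t "of_int (- i)"] i by simp
  then have "((\<lambda>s. F s + of_int (d * (- i))) has_real_derivative m) (at t)"
    by (simp only: per)
  then have "((\<lambda>s. (F s + of_int (d * (- i))) - of_int (d * (- i))) has_real_derivative m - 0) (at t)"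
    by (rule DERIV_diff) (rule DERIV_const)
  then show ?thesis
    by simp
qed

lemma has_slopeI:
  assumes "\<And>s. f (to_circle s) = to_circle (F s)" "(F has_real_derivative m) (at t)"
  shows "has_slope f (to_circle t) m"
  unfolding has_slope_def
  by (rule exI[of _ t], rule exI[of _ F]) (simp add: assms)

text \<open>The affine local lift differs from \<open>F\<close> by a constant near its base point,
  and a change of representative affects only the constant term.\<close>

lemma linear_near_lift:
  assumes lift: "\<And>s. f (to_circle s) = to_circle (F s)" and cont: "\<And>t. isCont F t"
    and per: "\<And>s i. F (s + of_int i) = F s + of_int (d * i)"
    and lin: "linear_near f (to_circle t)"
  shows "\<exists>a b. \<forall>\<^sub>F s in nhds t. F s = a * s + b"
proof -
  obtain t' a b where t': "to_circle t' = to_circle t"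
    and F': "\<forall>\<^sub>F s in nhds t'. f (to_circle s) = to_circle (a * s + b)"
    using lin unfolding linear_near_def by blast
  have "\<forall>\<^sub>F s in nhds t'. F s - (a * s + b) = F t' - (a * t' + b)"
  proof (rule eventually_const_if_Ints)
    show "isCont (\<lambda>s. F s - (a * s + b)) t'"
      using cont by (intro continuous_intros) auto
    show "\<forall>\<^sub>F s in nhds t'. F s - (a * s + b) \<in> \<int>"
      using F' by eventually_elim (simp add: lift to_circle_eq_iff)
  qed
  then have ev: "\<forall>\<^sub>F s in nhds t'. F s = a * s + (b + (F t' - (a * t' + b)))"
    by eventually_elim simp
  obtain i :: int where i: "t = t' + of_int i"
    using t' by (metis Ints_cases add.commute diff_add_cancel to_circle_eq_iff)
  have "filterlim (\<lambda>s. s + of_int (- i)) (nhds t') (nhds t)"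
  proof -
    have "isCont (\<lambda>s. s + of_int (- i)) t"
      by (intro continuous_intros)
    then have "((\<lambda>s. s + of_int (- i)) \<longlongrightarrow> t + of_int (- i)) (nhds t)"
      unfolding isCont_def tendsto_at_iff_tendsto_nhds[of "\<lambda>s. s + of_int (- i)" t] .
    then show ?thesis
      using i by simp
  qed
  then have "\<forall>\<^sub>F s in nhds t. F (s + of_int (- i)) = a * (s + of_int (- i)) + (b + (F t' - (a * t' + b)))"
    using ev by (rule eventually_compose_filterlim[rotated])
  then have "\<forall>\<^sub>F s in nhds t. F s + of_int (d * - i) = a * (s + of_int (- i)) + (b + (F t' - (a * t' + b)))"
    by (simp only: per)
  then have "\<forall>\<^sub>F s in nhds t. F s = a * s + (b + (F t' - (a * t' + b)) - a * of_int i + of_int (d * i))"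
    by eventually_elim (simp add: algebra_simps)
  then show ?thesis by blast
qed

section \<open>Affine functions on intervals\<close>

lemma eventually_DERIV_affine:
  fixes F :: "real \<Rightarrow> real"
  assumes "\<forall>\<^sub>F s in nhds t. F s = a * s + b"
  shows "\<forall>\<^sub>F s in nhds t. (F has_real_derivative a) (at s)"
proof -
  have "\<forall>\<^sub>F s in nhds t. \<forall>\<^sub>F u in nhds s. F u = a * u + b"
    using assms by (simp only: eventually_eventually)
  then show ?thesis
  proof eventually_elim
    case (elim s)
    have "((\<lambda>u. a * u + b) has_real_derivative a) (at s)"
      by (auto intro!: derivative_eq_intros)
    then show ?case
      using DERIV_cong_ev[OF refl elim refl] by blast
  qed
qed

text \<open>Local affinity makes the derivative locally constant, hence constant on the connected
  interior. Continuity extends the formula to the endpoints.\<close>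

lemma affine_on_interval:
  fixes F :: "real \<Rightarrow> real"
  assumes ab: "a < b" and cont: "continuous_on {a..b} F"
    and loc: "\<And>t. a < t \<Longrightarrow> t < b \<Longrightarrow> \<exists>\<alpha> \<beta>. \<forall>\<^sub>F s in nhds t. F s = \<alpha> * s + \<beta>"
  shows "\<exists>\<alpha> \<beta>. \<forall>t\<in>{a..b}. F t = \<alpha> * t + \<beta>"
proof -
  have loc': "\<exists>\<alpha>. \<forall>\<^sub>F s in nhds t. (F has_real_derivative \<alpha>) (at s)" if "a < t" "t < b" for t
    using loc[OF that] eventually_DERIV_affine by blast
  have "deriv F constant_on {a<..<b}"
  proof (rule locally_constant_imp_constant)
    show "connected {a<..<b}" by simp
    fix t assume "t \<in> {a<..<b}"
    then obtain \<alpha> where *: "\<forall>\<^sub>F s in nhds t. (F has_real_derivative \<alpha>) (at s)"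
      using loc'[of t] by auto
    then have ev: "\<forall>\<^sub>F s in nhds t. deriv F s = \<alpha>"
      by eventually_elim (rule DERIV_imp_deriv)
    then obtain T where T: "open T" "t \<in> T" "\<And>s. s \<in> T \<Longrightarrow> deriv F s = \<alpha>"
      by (auto simp: eventually_nhds)
    then show "\<exists>T. openin (top_of_set {a<..<b}) T \<and> t \<in> T \<and> (\<forall>s\<in>T. deriv F s = deriv F t)"
      using \<open>t \<in> {a<..<b}\<close> by (intro exI[of _ "{a<..<b} \<inter> T"]) (auto simp: openin_open_Int)
  qed
  then obtain \<alpha> where \<alpha>: "\<And>t. t \<in> {a<..<b} \<Longrightarrow> deriv F t = \<alpha>"
    by (auto simp: constant_on_def)
  have der: "(F has_real_derivative \<alpha>) (at t)" if t: "a < t" "t < b" for t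
  proof -
    obtain \<alpha>' where "\<forall>\<^sub>F s in nhds t. (F has_real_derivative \<alpha>') (at s)"
      using loc'[OF t] by blast
    then have "(F has_real_derivative \<alpha>') (at t)"
      by (rule eventually_nhds_x_imp_x)
    then show ?thesis
      using \<alpha>[of t] DERIV_imp_deriv t by fastforce
  qed
  have "F t - \<alpha> * t = F a - \<alpha> * a" if t: "t \<in> {a..b}" for t
  proof (rule DERIV_isconst2[of a b "\<lambda>t. F t - \<alpha> * t" t, OF ab])
    show "continuous_on {a..b} (\<lambda>t. F t - \<alpha> * t)"
      using cont by (intro continuous_intros)
    show "((\<lambda>t. F t - \<alpha> * t) has_real_derivative 0) (at x)" if "a < x" "x < b" for x
      using der[OF that] by (auto intro!: derivative_eq_intros)
  qed (use t in auto)
  then have "F t = \<alpha> * t + (F a - \<alpha> * a)" if "t \<in> {a..b}" for t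
    using that by (metis add_diff_cancel_left' diff_add_cancel add.commute)
  then show ?thesis by blast
qed

lemma DERIV_affine:
  fixes F :: "real \<Rightarrow> real"
  assumes aff: "\<And>s. s \<in> {c..d} \<Longrightarrow> F s = a * s + b" and t: "c < t" "t < d"
  shows "(F has_real_derivative a) (at t)"
proof (rule has_field_derivative_transform_within_open[of "\<lambda>s. a * s + b" _ _ "{c<..<d}"])
  show "((\<lambda>s. a * s + b) has_real_derivative a) (at t)"
    by (auto intro!: derivative_eq_intros)
qed (use t aff in auto)

text \<open>One-sided derivatives suffice, so \<open>t\<close> may be an endpoint. This compares the
  derivative at a point with the affine piece on either side.\<close>

lemma DERIV_affine_unique:
  fixes F :: "real \<Rightarrow> real"
  assumes der: "(F has_real_derivative m) (at t)" and cd: "c < d" "t \<in> {c..d}"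
    and aff: "\<And>s. s \<in> {c..d} \<Longrightarrow> F s = a * s + b"
  shows "m = a"
proof -
  have "(F has_real_derivative a) (at t within {c..d})"
  proof (rule has_field_derivative_transform_within[of "\<lambda>s. a * s + b" _ _ _ 1])
    show "((\<lambda>s. a * s + b) has_real_derivative a) (at t within {c..d})"
      by (auto intro!: derivative_eq_intros)
  qed (use cd aff in auto)
  moreover have "(F has_real_derivative m) (at t within {c..d})"
    using der by (rule has_field_derivative_at_within)
  moreover have "at t within {c..d} \<noteq> bot"
    using cd by (simp add: trivial_limit_within islimpt_Icc)
  ultimately show ?thesis
    by (simp add: has_field_derivative_iff tendsto_unique)
qed

section \<open>From local to uniform dyadic piecewise linearity\<close>

definition locally_dyadic_PL :: "(real \<Rightarrow> real) \<Rightarrow> bool"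
  where "locally_dyadic_PL F \<longleftrightarrow> (\<forall>x. \<exists>e>0. \<exists>i j :: int.
    (\<forall>t\<in>{0..e}. F (x + t) = F x + 2 powi i * t) \<and>
    (\<forall>t\<in>{0..e}. F (x - t) = F x - 2 powi j * t) \<and>
    (i \<noteq> j \<longrightarrow> x \<in> dyadic_reals))"

text \<open>Linearity on a punctured neighbourhood yields an affine piece on each side of
  \<open>x\<close>. If their slopes differ, \<open>f\<close> has no slope at the point, which is
  then a break and hence dyadic.\<close>

lemma T21_local_lift_locally_dyadic_PL:
  assumes f: "f \<in> T21_local UNIV"
    and lift: "\<And>s. f (to_circle s) = to_circle (F s)" and cont: "\<And>t. isCont F t"
    and per: "\<And>s i. F (s + of_int i) = F s + of_int (d * i)"
  shows "locally_dyadic_PL F"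
  unfolding locally_dyadic_PL_def
proof
  fix x
  have PL: "PL_on UNIV f" and slopes: "slopes_powers_of_2 UNIV f" and br: "breaks UNIV f \<subseteq> dyadic"
    using f by (auto simp: T21_local_def)
  obtain V where V: "open V" "to_circle x \<in> V"
    and lin: "\<And>y. y \<in> V - {to_circle x} \<Longrightarrow> linear_near f y"
    using PL[unfolded PL_on_def, THEN conjunct2, THEN bspec, OF UNIV_I[of "to_circle x"]] by metis
  have "open (to_circle -` V)"
    using V(1) by (simp add: open_circle_iff)
  then obtain e0 where e0: "e0 > 0" "ball x e0 \<subseteq> to_circle -` V"
    using V(2) openE[of "to_circle -` V" x] by auto
  \<comment> \<open>\<open>e < 1\<close> keeps other representatives of \<open>to_circle x\<close>,
    where linearity is not given, out of the neighbourhood.\<close>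
  define e where "e = min (e0 / 2) (1 / 2)"
  have e: "e > 0" "e < e0" "e < 1"
    using e0 by (auto simp: e_def)
  have loc: "\<exists>a b. \<forall>\<^sub>F s in nhds t. F s = a * s + b" if "\<bar>t - x\<bar> < e" "t \<noteq> x" for t
  proof -
    have "to_circle t \<noteq> to_circle x"
    proof
      assume "to_circle t = to_circle x"
      then have "t - x \<in> \<int>"
        by (simp add: to_circle_eq_iff)
      then show False
        using Ints_nonzero_abs_less1[of "t - x"] that e by auto
    qed
    moreover have "t \<in> ball x e0"
      using that e by (simp add: dist_real_def abs_minus_commute)
    ultimately have "linear_near f (to_circle t)"
      using e0 by (intro lin) auto
    then show ?thesis
      by (rule linear_near_lift[OF lift cont per])
  qed
  have cont_on: "continuous_on S F" for S
    using cont by (simp add: continuous_at_imp_continuous_on)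
  obtain a b where right: "\<And>t. t \<in> {x..x + e} \<Longrightarrow> F t = a * t + b"
    using affine_on_interval[of x "x + e" F] loc e cont_on by force
  obtain a' b' where left: "\<And>t. t \<in> {x - e..x} \<Longrightarrow> F t = a' * t + b'"
    using affine_on_interval[of "x - e" x F] loc e cont_on by force
  have slope: "\<exists>k::int. m = 2 powi k" if "(F has_real_derivative m) (at t)" for m t
    using slopes has_slopeI[OF lift that] by (auto simp: slopes_powers_of_2_def)
  obtain i :: int where i: "a = 2 powi i"
    using slope[OF DERIV_affine[of x "x + e" F a b "x + e / 2"]] right e(1) by auto
  obtain j :: int where j: "a' = 2 powi j"
    using slope[OF DERIV_affine[of "x - e" x F a' b' "x - e / 2"]] left e(1) by auto
  have "x \<in> dyadic_reals" if "i \<noteq> j"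
  proof (rule ccontr)
    assume "x \<notin> dyadic_reals"
    then have "to_circle x \<notin> breaks UNIV f"
      using br to_circle_in_dyadic_iff by blast
    then obtain m where "has_slope f (to_circle x) m"
      by (auto simp: breaks_def slope_dom_def)
    then have der: "(F has_real_derivative m) (at x)"
      by (rule has_slope_lift[OF lift cont per])
    have "m = a"
      using e(1) by (intro DERIV_affine_unique[OF der _ _ right]) auto
    moreover have "m = a'"
      using e(1) by (intro DERIV_affine_unique[OF der _ _ left]) auto
    ultimately show False
      using i j that powi_two_inject by metis
  qed
  moreover have "F (x + t) = F x + 2 powi i * t" if "t \<in> {0..e}" for t
    using right[of "x + t"] right[of x] that e i by (simp add: algebra_simps)
  moreover have "F (x - t) = F x - 2 powi j * t" if "t \<in> {0..e}" for t
    using left[of "x - t"] left[of x] that e j by (simp add: algebra_simps)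
  ultimately show "\<exists>e>0. \<exists>i j :: int.
    (\<forall>t\<in>{0..e}. F (x + t) = F x + 2 powi i * t) \<and>
    (\<forall>t\<in>{0..e}. F (x - t) = F x - 2 powi j * t) \<and>
    (i \<noteq> j \<longrightarrow> x \<in> dyadic_reals)"
    using e(1) by blast
qed

lemma cell_one_sided:
  assumes "x * 2 ^ n \<in> \<int>"
  shows "cell n p \<subseteq> {..x} \<or> cell n p \<subseteq> {x..}"
proof -
  obtain c where c: "x * 2 ^ n = of_int c"
    using assms by (auto elim: Ints_cases)
  then have x: "x = of_int c / 2 ^ n"
    by (simp add: field_simps)
  show ?thesis
  proof (cases "p < c")
    case True
    then have "of_int (p + 1) \<le> (of_int c :: real)"
      by (subst of_int_le_iff) simp
    then have "(of_int p + 1) / 2 ^ n \<le> x"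
      unfolding x by (intro divide_right_mono) simp_all
    then show ?thesis
      by (auto simp: cell_def)
  next
    case False
    then have "x \<le> of_int p / 2 ^ n"
      unfolding x by (intro divide_right_mono) simp_all
    then show ?thesis
      by (auto simp: cell_def)
  qed
qed

lemma cell_diff_le:
  assumes "x \<in> cell n p" "y \<in> cell n p"
  shows "\<bar>x - y\<bar> \<le> 1 / 2 ^ n"
  using assms by (auto simp: cell_def add_divide_distrib)

text \<open>Compactness, in the form of Bolzano's bisection principle. Asking for all levels
  \<open>n \<ge> M\<close> lets the bounds of two adjacent intervals be joined by taking their
  maximum.\<close>

lemma locally_dyadic_PL_imp_cells:
  assumes F: "locally_dyadic_PL F" and ab: "a \<le> b"
  shows "\<exists>M. \<forall>n\<ge>M. \<forall>p. cell n p \<inter> {a..b} \<noteq> {} \<longrightarrow>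
    (\<exists>j::int. \<exists>c. \<forall>t\<in>cell n p. F t = 2 powi j * t + c)"
  using ab
proof (induction rule: Bolzano)
  case (trans a b c)
  then obtain M M' where M: "\<And>n p. n \<ge> M \<Longrightarrow> cell n p \<inter> {a..b} \<noteq> {} \<Longrightarrow>
      \<exists>j::int. \<exists>c. \<forall>t\<in>cell n p. F t = 2 powi j * t + c"
    and M': "\<And>n p. n \<ge> M' \<Longrightarrow> cell n p \<inter> {b..c} \<noteq> {} \<Longrightarrow>
      \<exists>j::int. \<exists>c. \<forall>t\<in>cell n p. F t = 2 powi j * t + c"
    by metis
  have "{a..c} = {a..b} \<union> {b..c}"
    using trans by auto
  then have "\<exists>j::int. \<exists>c. \<forall>t\<in>cell n p. F t = 2 powi j * t + c"
    if "n \<ge> max M M'" "cell n p \<inter> {a..c} \<noteq> {}" for n p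
    using that M[of n p] M'[of n p] by auto
  then show ?case by blast
next
  case (local x)
  obtain e and i j :: int where e: "e > 0"
    and right: "\<And>t. t \<in> {0..e} \<Longrightarrow> F (x + t) = F x + 2 powi i * t"
    and left: "\<And>t. t \<in> {0..e} \<Longrightarrow> F (x - t) = F x - 2 powi j * t"
    and ij: "i \<noteq> j \<Longrightarrow> x \<in> dyadic_reals"
    using F unfolding locally_dyadic_PL_def by metis
  \<comment> \<open>\<open>M1\<close> keeps the cells that meet \<open>{a..b}\<close> within
    distance \<open>e\<close> of \<open>x\<close>. \<open>M2\<close> makes a break at
    \<open>x\<close> a grid point, so that every cell lies on one side of it.\<close>
  obtain M1 :: nat where M1: "(1 / 2) ^ M1 < e / 2"
    using real_arch_pow_inv[of "e / 2" "1 / 2"] e by auto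
  obtain M2 where M2: "i \<noteq> j \<Longrightarrow> x * 2 ^ M2 \<in> \<int>"
    using ij dyadic_reals_iff_Ints by metis
  have affine: "\<exists>k::int. \<exists>c. \<forall>t\<in>cell n p. F t = 2 powi k * t + c"
    if ab: "a \<le> x" "x \<le> b" "b - a < e / 2" and n: "n \<ge> max M1 M2"
      and meets: "cell n p \<inter> {a..b} \<noteq> {}" for a b n p
  proof -
    have "(1::real) / 2 ^ n \<le> 1 / 2 ^ M1"
      using n by (intro divide_left_mono power_increasing) simp_all
    then have small: "1 / 2 ^ n < e / 2"
      using M1 by (simp add: power_one_over)
    obtain y where y: "y \<in> cell n p" "y \<in> {a..b}"
      using meets by blast
    have near: "\<bar>t - x\<bar> \<le> e" if "t \<in> cell n p" for t
      using cell_diff_le[OF that y(1)] y(2) ab small by auto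
    have R: "F t = 2 powi i * t + (F x - 2 powi i * x)" if "t \<in> cell n p" "t \<ge> x" for t
      using right[of "t - x"] near[OF that(1)] that(2) by (simp add: algebra_simps)
    have L: "F t = 2 powi j * t + (F x - 2 powi j * x)" if "t \<in> cell n p" "t \<le> x" for t
      using left[of "x - t"] near[OF that(1)] that(2) by (simp add: algebra_simps)
    show ?thesis
    proof (cases "i = j")
      case True
      then have "F t = 2 powi i * t + (F x - 2 powi i * x)" if "t \<in> cell n p" for t
        using R[OF that] L[OF that] linear[of x t] by metis
      then show ?thesis by blast
    next
      case False
      then have "x * 2 ^ n \<in> \<int>"
        using M2 n Ints_mult_pow2_mono[of x M2 n] by simp
      then have "cell n p \<subseteq> {..x} \<or> cell n p \<subseteq> {x..}"
        by (rule cell_one_sided)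
      then show ?thesis
        using L R by (meson atLeast_iff atMost_iff subsetD)
    qed
  qed
  show ?case
  proof (rule exI[of _ "e / 2"], intro conjI allI impI)
    show "0 < e / 2"
      using e by simp
    show "\<exists>M. \<forall>n\<ge>M. \<forall>p. cell n p \<inter> {a..b} \<noteq> {} \<longrightarrow>
        (\<exists>j::int. \<exists>c. \<forall>t\<in>cell n p. F t = 2 powi j * t + c)"
      if "a \<le> x \<and> x \<le> b \<and> b - a < e / 2" for a b
      by (rule exI[of _ "max M1 M2"], intro allI impI, rule affine[of a b]) (use that in auto)
  qed
qed

text \<open>Every cell is an integer translate of one that meets \<open>{0..1}\<close>, and the
  quasi-periodicity carries the affine formula along.\<close>

lemma locally_dyadic_PL_imp_dyadic_PL:
  assumes F: "locally_dyadic_PL F" and per: "\<And>s i. F (s + of_int i) = F s + of_int (d * i)"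
  shows "dyadic_PL F"
proof -
  obtain M where M: "\<And>p. cell M p \<inter> {0..1} \<noteq> {} \<Longrightarrow>
      \<exists>j::int. \<exists>c. \<forall>t\<in>cell M p. F t = 2 powi j * t + c"
    using locally_dyadic_PL_imp_cells[OF F zero_le_one] by blast
  have "\<exists>j::int. \<exists>c. \<forall>t\<in>cell M p. F t = 2 powi j * t + c" for p
  proof -
    define q where "q = p div 2 ^ M"
    define r where "r = p mod 2 ^ M"
    have p: "p = q * 2 ^ M + r" and r: "0 \<le> r" "r < 2 ^ M"
      unfolding q_def r_def by (simp_all only: div_mult_mod_eq) simp_all
    have "of_int r \<le> (of_int (2 ^ M) :: real)"
      using r by (subst of_int_le_iff) simp
    then have "of_int r / 2 ^ M \<in> cell M r \<inter> {0..1}"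
      using r by (simp add: cell_def divide_right_mono)
    then obtain j :: int and c where jc: "\<And>t. t \<in> cell M r \<Longrightarrow> F t = 2 powi j * t + c"
      using M[of r] by blast
    have "F t = 2 powi j * t + (c - 2 powi j * of_int q + of_int (d * q))" if t: "t \<in> cell M p" for t
    proof -
      have "of_int p / 2 ^ M = of_int q + (of_int r / 2 ^ M :: real)"
        by (simp add: p add_divide_distrib)
      then have "t - of_int q \<in> cell M r"
        using t by (simp add: cell_def add_divide_distrib)
      then have "F (t - of_int q) = 2 powi j * (t - of_int q) + c"
        by (rule jc)
      then show ?thesis
        using per[of "t - of_int q" q] by (simp add: algebra_simps)
    qed
    then show ?thesis by blast
  qed
  then show ?thesis
    unfolding dyadic_PL_def by blast
qed

section \<open>Lifts of circle homeomorphisms\<close>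

lemma circle_homeo_lift:
  assumes h: "orientation_preserving_homeo h"
  obtains H where "continuous_on UNIV H" "strict_mono H"
    "\<And>t. h (to_circle t) = to_circle (H t)" "\<And>t. H (t + 1) = H t + 1"
proof -
  obtain F where F: "continuous_on UNIV F" "strict_mono F"
    and lift: "\<And>t. h (to_circle t) = to_circle (F t)"
    using h unfolding orientation_preserving_homeo_def by blast
  obtain g where "homeomorphism UNIV UNIV h g"
    using h unfolding orientation_preserving_homeo_def by blast
  then have g: "g (h x) = x" for x
    by (simp add: homeomorphism_def)
  have "F (t + 1) = F t + 1" for t
  proof (rule antisym)
    have "to_circle (F (t + 1)) = to_circle (F t)"
      using lift to_circle_add_int[of t 1] by (metis of_int_1)
    then obtain k :: int where k: "F (t + 1) - F t = of_int k"
      by (auto simp: to_circle_eq_iff elim: Ints_cases)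
    have "F t < F (t + 1)"
      using F(2) by (simp add: strict_mono_less)
    then have "k > 0"
      using k by simp
    then show "F t + 1 \<le> F (t + 1)"
      using k by simp
    show "F (t + 1) \<le> F t + 1"
    proof (rule ccontr)
      assume gt: "\<not> F (t + 1) \<le> F t + 1"
      \<comment> \<open>If \<open>F\<close> grew by more than 1 over a period, it would take the
        value \<open>F t + 1\<close> strictly inside the period, and \<open>h\<close> would identify
        two distinct points.\<close>
      obtain s where s: "t \<le> s" "s \<le> t + 1" "F s = F t + 1"
        using IVT'[of F t "F t + 1" "t + 1"] gt continuous_on_subset[OF F(1)] by auto
      have "h (to_circle s) = h (to_circle t)"
        using s(3) by (simp add: lift to_circle_eq_iff)
      then have "s - t \<in> \<int>"
        using g by (metis to_circle_eq_iff)
      moreover have "s \<noteq> t" "s \<noteq> t + 1"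
        using s(3) gt by auto
      ultimately show False
        using Ints_nonzero_abs_less1[of "s - t"] s by auto
    qed
  qed
  then show thesis
    using that F lift by blast
qed

lemma surj_if_shift:
  fixes H :: "real \<Rightarrow> real"
  assumes cont: "continuous_on UNIV H" and shift: "\<And>t. H (t + 1) = H t + 1"
  shows "surj H"
  unfolding surj_def
proof
  fix y
  define i where "i = \<lfloor>y - H 0\<rfloor>"
  have "H (of_int i) = H 0 + of_int i" "H (of_int i + 1) = H 0 + of_int i + 1"
    using shift_of_int[of H 0 i] shift by simp_all
  then have "H (of_int i) \<le> y" "y \<le> H (of_int i + 1)"
    unfolding i_def by linarith+
  then obtain x where "H x = y"
    using IVT'[of H "of_int i" y "of_int i + 1"] continuous_on_subset[OF cont] by auto
  then show "\<exists>x. y = H x"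
    by blast
qed

section \<open>From a dyadic PL lift back to the circle\<close>

lemma dyadic_PL_affine_near:
  assumes M: "\<And>p. \<exists>j::int. \<exists>b. \<forall>x\<in>cell M p. H x = 2 powi j * x + b"
    and t: "t * 2 ^ M \<notin> \<int>"
  shows "\<exists>a b. \<forall>\<^sub>F s in nhds t. H s = a * s + b"
proof -
  define p where "p = \<lfloor>t * 2 ^ M\<rfloor>"
  have "of_int p \<noteq> t * 2 ^ M"
    using t by (metis Ints_of_int)
  then have "of_int p < t * 2 ^ M" "t * 2 ^ M < of_int p + 1"
    unfolding p_def by linarith+
  then have "t \<in> {of_int p / 2 ^ M <..< (of_int p + 1) / 2 ^ M}"
    by (simp add: divide_less_eq less_divide_eq)
  then have ev: "\<forall>\<^sub>F s in nhds t. s \<in> {of_int p / 2 ^ M <..< (of_int p + 1) / 2 ^ M}"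
    by (intro eventually_nhds_in_open) auto
  obtain j :: int and b where jb: "\<And>x. x \<in> cell M p \<Longrightarrow> H x = 2 powi j * x + b"
    using M by blast
  have "\<forall>\<^sub>F s in nhds t. H s = 2 powi j * s + b"
    using ev by eventually_elim (rule jb, auto simp: cell_def)
  then show ?thesis by blast
qed

text \<open>The slope is constant on the image of a neighbourhood of \<open>t\<close>, which is open
  in the circle. \<open>has_slope_lift\<close> gives the uniqueness that \<open>slope\<close>
  needs.\<close>

lemma not_break_if_affine_near:
  assumes lift: "\<And>s. h (to_circle s) = to_circle (H s)" and cont: "\<And>t. isCont H t"
    and per: "\<And>s i. H (s + of_int i) = H s + of_int (d * i)"
    and aff: "\<forall>\<^sub>F s in nhds t. H s = a * s + b"
  shows "to_circle t \<notin> breaks UNIV h"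
proof -
  have "\<forall>\<^sub>F s in nhds t. (H has_real_derivative a) (at s)"
    using aff by (rule eventually_DERIV_affine)
  then obtain T where T: "open T" "t \<in> T" "\<And>s. s \<in> T \<Longrightarrow> (H has_real_derivative a) (at s)"
    by (auto simp: eventually_nhds)
  have has: "has_slope h (to_circle s) a" if "s \<in> T" for s
    using lift T(3)[OF that] by (rule has_slopeI)
  have eq: "slope h (to_circle s) = a" if "s \<in> T" for s
    unfolding slope_def
  proof (rule the_equality)
    show "has_slope h (to_circle s) a"
      using that by (rule has)
    show "m = a" if "has_slope h (to_circle s) m" for m
      using has_slope_lift[OF lift cont per that] T(3)[OF \<open>s \<in> T\<close>] by (rule DERIV_unique)
  qed
  have "(slope h \<longlongrightarrow> a) (at (to_circle t) within slope_dom UNIV h)"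
  proof (rule tendsto_eventually)
    show "\<forall>\<^sub>F y in at (to_circle t) within slope_dom UNIV h. slope h y = a"
      unfolding eventually_at_topological
      using T eq open_to_circle_image[OF T(1)] by (intro exI[of _ "to_circle ` T"]) auto
  qed
  then show ?thesis
    using T(2) has eq by (auto simp: breaks_def slope_dom_def)
qed

lemma grid_neighbourhood:
  obtains V where "open V" "to_circle t \<in> V"
    "\<And>y. y \<in> V \<Longrightarrow> y \<noteq> to_circle t \<Longrightarrow> \<exists>s. y = to_circle s \<and> s * 2 ^ M \<notin> \<int>"
proof
  \<comment> \<open>All grid points other than \<open>t\<close> are removed. The rest is open
    because every set of integers is closed.\<close>
  define U where "U = (\<lambda>s::real. s * 2 ^ M) -` (- (\<int> - {t * 2 ^ M}))"
  have "closed (\<int> - {t * 2 ^ M} :: real set)"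
    by (rule closed_subset_Ints) blast
  then have "open U"
    unfolding U_def by (intro open_vimage open_Compl) (auto intro!: continuous_intros)
  then show "open (to_circle ` U)"
    by (rule open_to_circle_image)
  show "to_circle t \<in> to_circle ` U"
    by (auto simp: U_def)
  show "\<exists>s. y = to_circle s \<and> s * 2 ^ M \<notin> \<int>" if "y \<in> to_circle ` U" "y \<noteq> to_circle t" for y
    using that by (auto simp: U_def)
qed

lemma dyadic_PL_lift_T21:
  assumes h: "orientation_preserving_homeo h" "h ` dyadic \<subseteq> dyadic"
    and lift: "\<And>s. h (to_circle s) = to_circle (H s)" and cont: "\<And>t. isCont H t"
    and per: "\<And>s i. H (s + of_int i) = H s + of_int (d * i)"
    and PL: "dyadic_PL H"
  shows "h \<in> T21"
proof -
  obtain M where M: "\<And>p. \<exists>j::int. \<exists>b. \<forall>x\<in>cell M p. H x = 2 powi j * x + b"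
    using PL unfolding dyadic_PL_def by blast
  have regular: "to_circle s \<notin> breaks UNIV h" "linear_near h (to_circle s)"
    if s: "s * 2 ^ M \<notin> \<int>" for s
  proof -
    obtain a b where ab: "\<forall>\<^sub>F u in nhds s. H u = a * u + b"
      using dyadic_PL_affine_near[OF M s] by blast
    then show "to_circle s \<notin> breaks UNIV h"
      by (rule not_break_if_affine_near[OF lift cont per])
    have "\<forall>\<^sub>F u in nhds s. h (to_circle u) = to_circle (a * u + b)"
      using ab by eventually_elim (simp add: lift)
    then show "linear_near h (to_circle s)"
      unfolding linear_near_def by blast
  qed
  have "continuous_on UNIV h"
    using h(1) by (auto simp: orientation_preserving_homeo_def homeomorphism_def)
  moreover have "\<exists>V. open V \<and> x \<in> V \<and> V \<subseteq> UNIV \<and> (\<forall>y\<in>V - {x}. y \<notin> breaks UNIV h \<and> linear_near h y)" for x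
  proof -
    obtain t where t: "x = to_circle t"
      using to_circle_surj by metis
    obtain V where "open V" "to_circle t \<in> V"
      "\<And>y. y \<in> V \<Longrightarrow> y \<noteq> to_circle t \<Longrightarrow> \<exists>s. y = to_circle s \<and> s * 2 ^ M \<notin> \<int>"
      by (rule grid_neighbourhood[of t M]) blast
    then show ?thesis
      using regular t by (intro exI[of _ V]) blast
  qed
  ultimately have "PL_on UNIV h"
    unfolding PL_on_def by blast
  moreover have "slopes_powers_of_2 UNIV h"
    unfolding slopes_powers_of_2_def
  proof (intro ballI allI impI)
    fix x m assume m: "has_slope h x m"
    obtain t where t: "x = to_circle t"
      using to_circle_surj by metis
    have der: "(H has_real_derivative m) (at t)"
      using m unfolding t by (rule has_slope_lift[OF lift cont per])
    \<comment> \<open>At a grid point this is the cell to the right; a derivative, where it exists,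
      equals the slope on that side.\<close>
    define p where "p = \<lfloor>t * 2 ^ M\<rfloor>"
    obtain j :: int and b where jb: "\<And>x. x \<in> cell M p \<Longrightarrow> H x = 2 powi j * x + b"
      using M by blast
    have "of_int p \<le> t * 2 ^ M" "t * 2 ^ M \<le> of_int p + 1"
      unfolding p_def by linarith+
    then have "t \<in> {of_int p / 2 ^ M..(of_int p + 1) / 2 ^ M}"
      by (simp add: divide_le_eq le_divide_eq)
    then have "m = 2 powi j"
      using jb by (intro DERIV_affine_unique[OF der]) (auto simp: cell_def divide_strict_right_mono)
    then show "\<exists>k::int. m = 2 powi k"
      by blast
  qed
  \<comment> \<open>The image of the whole grid of level \<open>M\<close> serves as
    \<open>B\<close>.\<close>
  moreover have "\<exists>B. B \<subseteq> dyadic \<and> discrete B \<and> breaks UNIV h \<subseteq> B"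
  proof (intro exI[of _ "to_circle ` {s. s * 2 ^ M \<in> \<int>}"] conjI)
    show "to_circle ` {s. s * 2 ^ M \<in> \<int>} \<subseteq> dyadic"
      by (auto simp: to_circle_in_dyadic_iff dyadic_reals_iff_Ints)
    show "discrete (to_circle ` {s. s * 2 ^ M \<in> \<int>})"
      unfolding discrete_altdef
    proof
      fix x assume "x \<in> to_circle ` {s. s * 2 ^ M \<in> \<int>}"
      then obtain t where t: "x = to_circle t"
        by blast
      obtain V where V: "open V" "to_circle t \<in> V"
        "\<And>y. y \<in> V \<Longrightarrow> y \<noteq> to_circle t \<Longrightarrow> \<exists>s. y = to_circle s \<and> s * 2 ^ M \<notin> \<int>"
        by (rule grid_neighbourhood[of t M]) blast
      have "y \<notin> to_circle ` {s. s * 2 ^ M \<in> \<int>}" if y: "y \<in> V" "y \<noteq> x" for y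
      proof
        assume "y \<in> to_circle ` {s. s * 2 ^ M \<in> \<int>}"
        then obtain u where u: "y = to_circle u" "u * 2 ^ M \<in> \<int>"
          by blast
        obtain s where s: "y = to_circle s" "s * 2 ^ M \<notin> \<int>"
          using V(3) y t by blast
        \<comment> \<open>Being on the grid does not depend on the representative of a point of the
          circle.\<close>
        have "s - u \<in> \<int>"
          using u s by (simp add: to_circle_eq_iff)
        then have "(s - u) * 2 ^ M \<in> \<int>"
          by (rule Ints_mult) simp
        then have "(s - u) * 2 ^ M + u * 2 ^ M \<in> \<int>"
          using u(2) by (rule Ints_add)
        then show False
          using s(2) by (simp add: left_diff_distrib)
      qed
      then show "\<forall>\<^sub>F y in at x. y \<notin> to_circle ` {s. s * 2 ^ M \<in> \<int>}"
        unfolding eventually_at_topological using V(1,2) t by blast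
    qed
    show "breaks UNIV h \<subseteq> to_circle ` {s. s * 2 ^ M \<in> \<int>}"
    proof
      fix x assume "x \<in> breaks UNIV h"
      moreover obtain t where "x = to_circle t"
        using to_circle_surj by metis
      ultimately show "x \<in> to_circle ` {s. s * 2 ^ M \<in> \<int>}"
        using regular(1)[of t] by blast
    qed
  qed
  ultimately show ?thesis
    using h by (simp add: T21_def)
qed

theorem theorem2:
  fixes h :: "circle \<Rightarrow> circle"
  assumes "orientation_preserving_homeo h"
    and "h ` dyadic = dyadic"
    and "h \<circ> nu2 \<circ> inv h \<in> T21_local UNIV"
    and "inv h \<circ> nu2 \<circ> h \<in> T21_local UNIV"
  shows "h \<in> T21"
proof -
  obtain H where H_cont: "continuous_on UNIV H" and H_mono: "strict_mono H"
    and lift: "\<And>t. h (to_circle t) = to_circle (H t)" and shift: "\<And>t. H (t + 1) = H t + 1"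
    using circle_homeo_lift[OF assms(1)] by blast
  have H_int: "H (t + of_int i) = H t + of_int i" for t i
    using shift by (rule shift_of_int)
  define G where "G = inv H"
  have HG: "H (G y) = y" for y
    unfolding G_def using surj_if_shift[OF H_cont shift] by (rule surj_f_inv_f)
  have GH: "G (H x) = x" for x
    unfolding G_def using H_mono by (intro inv_f_f strict_mono_imp_inj_on)
  have G_int: "G (y + of_int i) = G y + of_int i" for y i
    by (metis HG GH H_int)
  have G_mono: "G x \<le> G y" if "x \<le> y" for x y
    using that H_mono HG by (metis strict_mono_less_eq)
  have "range G = UNIV"
    using GH by (metis surjI)
  \<comment> \<open>A monotone surjection has no jumps.\<close>
  then have "continuous_on UNIV G"
    using G_mono by (intro continuous_onI_mono) auto
  then have contG: "isCont G t" for t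
    by (simp add: continuous_on_eq_continuous_at)
  have contH: "isCont H t" for t
    using H_cont by (simp add: continuous_on_eq_continuous_at)
  obtain g where "homeomorphism UNIV UNIV h g"
    using assms(1) unfolding orientation_preserving_homeo_def by blast
  then have "inj h"
    by (metis homeomorphism_def UNIV_I injI)
  then have inv_lift: "inv h (to_circle y) = to_circle (G y)" for y
    by (intro inv_f_eq) (simp_all add: lift HG)
  have H_dyadic: "H x \<in> dyadic_reals" if "x \<in> dyadic_reals" for x
  proof -
    have "to_circle (H x) \<in> dyadic"
      using that assms(2) by (auto simp: to_circle_in_dyadic_iff simp flip: lift)
    then show ?thesis
      by (simp add: to_circle_in_dyadic_iff)
  qed
  have G_dyadic: "G x \<in> dyadic_reals" if "x \<in> dyadic_reals" for x
  proof -
    have "to_circle x \<in> h ` dyadic"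
      using that assms(2) by (simp add: to_circle_in_dyadic_iff)
    then have "inv h (to_circle x) \<in> dyadic"
      using \<open>inj h\<close> by (auto simp: inv_f_f)
    then show ?thesis
      by (simp add: inv_lift to_circle_in_dyadic_iff)
  qed
  \<comment> \<open>The conjugates of \<open>nu2\<close> have lifts of degree 2. Membership in
    \<open>T21_local\<close> makes these lifts locally affine on both sides of each point, and
    periodicity yields a uniform grid.\<close>
  have "dyadic_PL (\<lambda>y. H (2 * G y))"
  proof (rule locally_dyadic_PL_imp_dyadic_PL)
    show per: "H (2 * G (s + of_int i)) = H (2 * G s) + of_int (2 * i)" for s i
      using H_int[of "2 * G s" "2 * i"] by (simp add: G_int distrib_left)
    show "locally_dyadic_PL (\<lambda>y. H (2 * G y))"
    proof (rule T21_local_lift_locally_dyadic_PL[OF assms(3) _ _ per])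
      show "(h \<circ> nu2 \<circ> inv h) (to_circle s) = to_circle (H (2 * G s))" for s
        by (simp add: lift inv_lift)
      show "isCont (\<lambda>y. H (2 * G y)) t" for t
        by (intro isCont_o2[OF _ contH] continuous_intros contG)
    qed
  qed
  moreover have "dyadic_PL (\<lambda>x. G (2 * H x))"
  proof (rule locally_dyadic_PL_imp_dyadic_PL)
    show per: "G (2 * H (s + of_int i)) = G (2 * H s) + of_int (2 * i)" for s i
      using G_int[of "2 * H s" "2 * i"] by (simp add: H_int distrib_left)
    show "locally_dyadic_PL (\<lambda>x. G (2 * H x))"
    proof (rule T21_local_lift_locally_dyadic_PL[OF assms(4) _ _ per])
      show "(inv h \<circ> nu2 \<circ> h) (to_circle s) = to_circle (G (2 * H s))" for s
        by (simp add: lift inv_lift)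
      show "isCont (\<lambda>x. G (2 * H x)) t" for t
        by (intro isCont_o2[OF _ contG] continuous_intros contH)
    qed
  qed
  ultimately interpret doubling_conjugacy H G
    using H_mono HG GH shift H_dyadic G_dyadic by unfold_locales
  show ?thesis
  proof (rule dyadic_PL_lift_T21[OF assms(1) _ lift contH])
    show "H (s + of_int i) = H s + of_int (1 * i)" for s i
      by (simp add: H_int)
  qed (use assms(2) H_affine_on_small_cells in auto)
qed

end
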